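(* Let $\mathcal{E}$ be an elementary topos. The following are equivalent: (i) The internal logic of $\mathcal{E}$ is the full $\varepsilon$-calculus. (ii) $\mathcal{E}$ is an $\varepsilon$-topos, i.e. $\mathcal{E}$ validates the axiom of choice (every epimorphism in $\mathcal{E}$ has a section) and for every non-initial object $A$ of $\mathcal{E}$ the unique arrow $A\to1$ is an epimorphism.
   Context: **Internal logic.** In the internal language of an elementary topos $\mathcal{E}$ (with terminal object $1$ and initial object $0$), types are objects of $\mathcal{E}$; a context $\Gamma=(x_1:A_1,\dots,x_n:A_n)$ is a finite list of typed variables, identified with the product $A_1\times\dots\times A_n$ (the empty context is $1$); terms of type $B$ in context $\Gamma$ are arrows $\Gamma\to B$; formulas in context $\Gamma$ are monomorphisms with codomain $\Gamma$. A sequent $\Gamma\mid\phi\vdash\psi$ is derivable iff the monomorphism representing $\phi$ factors through the one representing $\psi$. Substitution of terms is pullback, and for a formula $\psi:X\rightarrowtail\Gamma\times A$ the formula $\Gamma\mid\exists x:A.\,\psi$ is represented by the image $\mathrm{Im}(\pi_\Gamma\circ\psi)\rightarrowtail\Gamma$, where $\pi_\Gamma:\Gamma\times A\to\Gamma$ is the projection. **Full $\varepsilon$-calculus.** The internal logic of $\mathcal{E}$ is the (full) $\varepsilon$-calculus if for every context $\Gamma$ none of whose types is initial, every non-initial object $A$, and every formula $\psi$ in context $\Gamma,x:A$ (i.e. every monomorphism $\psi:X\rightarrowtail\Gamma\times A$), there is a term $\Gamma\mid\varepsilon^x_\psi:A$ (i.e. an arrow $\varepsilon^x_\psi:\Gamma\to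 A$) such that the sequent $\Gamma\mid\exists x:A.\,\psi\vdash\psi[\varepsilon^x_\psi/x]$ is derivable; that is, $\mathrm{Im}(\pi_\Gamma\circ\psi)\rightarrowtail\Gamma$ factors through the pullback of $\psi$ along $\langle \mathrm{id}_\Gamma,\varepsilon^x_\psi\rangle:\Gamma\to\Gamma\times A$. *)

theory Defs
  imports Main
begin

section \<open>Categories\<close>

record ('o, 'm) category_data =
  Obj :: "'o set"
  Arr :: "'m set"
  Dom :: "'m \<Rightarrow> 'o"
  Cod :: "'m \<Rightarrow> 'o"
  Ide :: "'o \<Rightarrow> 'm"
  Comp :: "'m \<Rightarrow> 'm \<Rightarrow> 'm" (infixr "\<cdot>\<index>" 55)

definition hom :: "('o, 'm) category_data \<Rightarrow> 'o \<Rightarrow> 'o \<Rightarrow> 'm set" where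
  "hom C A B = {f \<in> Arr C. Dom C f = A \<and> Cod C f = B}"

locale category =
  fixes C :: "('o, 'm) category_data" (structure)
  assumes Dom_Obj: "f \<in> Arr C \<Longrightarrow> Dom C f \<in> Obj C"
    and Cod_Obj: "f \<in> Arr C \<Longrightarrow> Cod C f \<in> Obj C"
    and Ide_hom: "A \<in> Obj C \<Longrightarrow> Ide C A \<in> hom C A A"
    and Comp_hom: "f \<in> hom C A B \<Longrightarrow> g \<in> hom C B D \<Longrightarrow> g \<cdot> f \<in> hom C A D"
    and Comp_Ide: "f \<in> hom C A B \<Longrightarrow> f \<cdot> Ide C A = f"
    and Ide_Comp: "f \<in> hom C A B \<Longrightarrow> Ide C B \<cdot> f = f"
    and Comp_assoc: "f \<in> hom C A B \<Longrightarrow> g \<in> hom C B D \<Longrightarrow> h \<in> hom C D E \<Longrightarrow>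
                     (h \<cdot> g) \<cdot> f = h \<cdot> (g \<cdot> f)"

definition monic :: "('o, 'm) category_data \<Rightarrow> 'm \<Rightarrow> bool" where
  "monic C m \<longleftrightarrow> m \<in> Arr C \<and>
     (\<forall>X. \<forall>f \<in> hom C X (Dom C m). \<forall>g \<in> hom C X (Dom C m).
        m \<cdot>\<^bsub>C\<^esub> f = m \<cdot>\<^bsub>C\<^esub> g \<longrightarrow> f = g)"

definition epic :: "('o, 'm) category_data \<Rightarrow> 'm \<Rightarrow> bool" where
  "epic C e \<longleftrightarrow> e \<in> Arr C \<and>
     (\<forall>X. \<forall>f \<in> hom C (Cod C e) X. \<forall>g \<in> hom C (Cod C e) X.
        f \<cdot>\<^bsub>C\<^esub> e = g \<cdot>\<^bsub>C\<^esub> e \<longrightarrow> f = g)"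

definition terminal :: "('o, 'm) category_data \<Rightarrow> 'o \<Rightarrow> bool" where
  "terminal C T \<longleftrightarrow> T \<in> Obj C \<and> (\<forall>X \<in> Obj C. \<exists>!f. f \<in> hom C X T)"

definition initial :: "('o, 'm) category_data \<Rightarrow> 'o \<Rightarrow> bool" where
  "initial C I \<longleftrightarrow> I \<in> Obj C \<and> (\<forall>X \<in> Obj C. \<exists>!f. f \<in> hom C I X)"

definition is_binprod ::
  "('o, 'm) category_data \<Rightarrow> 'o \<Rightarrow> 'o \<Rightarrow> 'o \<Rightarrow> 'm \<Rightarrow> 'm \<Rightarrow> bool" where
  "is_binprod C A B P p q \<longleftrightarrow> p \<in> hom C P A \<and> q \<in> hom C P B \<and>
     (\<forall>X. \<forall>f \<in> hom C X A. \<forall>g \<in> hom C X B.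
        \<exists>!h. h \<in> hom C X P \<and> p \<cdot>\<^bsub>C\<^esub> h = f \<and> q \<cdot>\<^bsub>C\<^esub> h = g)"

text \<open>A product of a finite list of objects; for the empty list, \<open>P\<close> is a terminal object.\<close>

definition is_list_product ::
  "('o, 'm) category_data \<Rightarrow> 'o list \<Rightarrow> 'o \<Rightarrow> 'm list \<Rightarrow> bool" where
  "is_list_product C As P ps \<longleftrightarrow> P \<in> Obj C \<and>
     list_all2 (\<lambda>p A. p \<in> hom C P A) ps As \<and>
     (\<forall>X \<in> Obj C. \<forall>fs. list_all2 (\<lambda>f A. f \<in> hom C X A) fs As \<longrightarrow>
        (\<exists>!h. h \<in> hom C X P \<and> map (\<lambda>p. p \<cdot>\<^bsub>C\<^esub> h) ps = fs))"

text \<open>The square \<open>f \<cdot> p = g \<cdot> q\<close> is a pullback square.\<close>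

definition is_pullback ::
  "('o, 'm) category_data \<Rightarrow> 'm \<Rightarrow> 'm \<Rightarrow> 'm \<Rightarrow> 'm \<Rightarrow> bool" where
  "is_pullback C p q f g \<longleftrightarrow>
     f \<in> Arr C \<and> g \<in> Arr C \<and> Cod C f = Cod C g \<and>
     p \<in> hom C (Dom C p) (Dom C f) \<and> q \<in> hom C (Dom C p) (Dom C g) \<and>
     f \<cdot>\<^bsub>C\<^esub> p = g \<cdot>\<^bsub>C\<^esub> q \<and>
     (\<forall>X. \<forall>u \<in> hom C X (Dom C f). \<forall>v \<in> hom C X (Dom C g).
        f \<cdot>\<^bsub>C\<^esub> u = g \<cdot>\<^bsub>C\<^esub> v \<longrightarrow>
        (\<exists>!h. h \<in> hom C X (Dom C p) \<and> p \<cdot>\<^bsub>C\<^esub> h = u \<and> q \<cdot>\<^bsub>C\<^esub> h = v))"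

section \<open>Elementary toposes\<close>

definition finitely_complete :: "('o, 'm) category_data \<Rightarrow> bool" where
  "finitely_complete C \<longleftrightarrow> (\<exists>T. terminal C T) \<and>
     (\<forall>f \<in> Arr C. \<forall>g \<in> Arr C. Cod C f = Cod C g \<longrightarrow> (\<exists>p q. is_pullback C p q f g))"

text \<open>
  \<open>E\<close> is an exponential \<open>B\<^sup>A\<close> with evaluation \<open>ev : P \<rightarrow> B\<close>, where \<open>(P, p, q)\<close> is a
  product of \<open>E\<close> and \<open>A\<close>. The arrow \<open>h\<close> below is \<open>g \<times> id\<^sub>A\<close>.
\<close>

definition is_exponential ::
  "('o, 'm) category_data \<Rightarrow> 'o \<Rightarrow> 'o \<Rightarrow> 'o \<Rightarrow> 'o \<Rightarrow> 'm \<Rightarrow> 'm \<Rightarrow> 'm \<Rightarrow> bool" where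
  "is_exponential C A B E P p q ev \<longleftrightarrow> is_binprod C E A P p q \<and> ev \<in> hom C P B \<and>
     (\<forall>X Q p' q'. is_binprod C X A Q p' q' \<longrightarrow>
        (\<forall>f \<in> hom C Q B. \<exists>!g. g \<in> hom C X E \<and>
           (\<exists>h \<in> hom C Q P. p \<cdot>\<^bsub>C\<^esub> h = g \<cdot>\<^bsub>C\<^esub> p' \<and> q \<cdot>\<^bsub>C\<^esub> h = q' \<and>
              ev \<cdot>\<^bsub>C\<^esub> h = f)))"

definition cartesian_closed :: "('o, 'm) category_data \<Rightarrow> bool" where
  "cartesian_closed C \<longleftrightarrow> (\<exists>T. terminal C T) \<and>
     (\<forall>A \<in> Obj C. \<forall>B \<in> Obj C. \<exists>P p q. is_binprod C A B P p q) \<and>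
     (\<forall>A \<in> Obj C. \<forall>B \<in> Obj C. \<exists>E P p q ev. is_exponential C A B E P p q ev)"

definition is_subobject_classifier ::
  "('o, 'm) category_data \<Rightarrow> 'o \<Rightarrow> 'o \<Rightarrow> 'm \<Rightarrow> bool" where
  "is_subobject_classifier C T \<Omega> t \<longleftrightarrow> terminal C T \<and> t \<in> hom C T \<Omega> \<and>
     (\<forall>m. monic C m \<longrightarrow>
        (\<exists>!\<chi>. \<chi> \<in> hom C (Cod C m) \<Omega> \<and>
           (\<exists>u \<in> hom C (Dom C m) T. is_pullback C m u \<chi> t)))"

definition elementary_topos :: "('o, 'm) category_data \<Rightarrow> bool" where
  "elementary_topos C \<longleftrightarrow> category C \<and> finitely_complete C \<and> cartesian_closed C \<and>
     (\<exists>T \<Omega> t. is_subobject_classifier C T \<Omega> t)"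

section \<open>The internal logic and the full epsilon calculus\<close>

definition factors_through :: "('o, 'm) category_data \<Rightarrow> 'm \<Rightarrow> 'm \<Rightarrow> bool" where
  "factors_through C f m \<longleftrightarrow> (\<exists>h \<in> hom C (Dom C f) (Dom C m). m \<cdot>\<^bsub>C\<^esub> h = f)"

text \<open>
  Formulas over an object \<open>G\<close> are monomorphisms with codomain \<open>G\<close> (not equivalence classes
  of such).
\<close>

definition is_formula :: "('o, 'm) category_data \<Rightarrow> 'o \<Rightarrow> 'm \<Rightarrow> bool" where
  "is_formula C G \<phi> \<longleftrightarrow> monic C \<phi> \<and> Cod C \<phi> = G"

definition derivable :: "('o, 'm) category_data \<Rightarrow> 'o \<Rightarrow> 'm \<Rightarrow> 'm \<Rightarrow> bool" where
  "derivable C G \<phi> \<psi> \<longleftrightarrow> is_formula C G \<phi> \<and> is_formula C G \<psi> \<and> factors_through C \<phi> \<psi>"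

text \<open>The image of \<open>f\<close> is the least subobject of its codomain through which \<open>f\<close> factors.\<close>

definition is_image :: "('o, 'm) category_data \<Rightarrow> 'm \<Rightarrow> 'm \<Rightarrow> bool" where
  "is_image C f m \<longleftrightarrow> is_formula C (Cod C f) m \<and> factors_through C f m \<and>
     (\<forall>n. is_formula C (Cod C f) n \<and> factors_through C f n \<longrightarrow> factors_through C m n)"

text \<open>
  The interpretations of existential quantification and of substitution are determined only
  up to isomorphism of subobjects, hence are stated as relations. Below, \<open>\<pi> : P \<rightarrow> G\<close> and
  \<open>q : P \<rightarrow> A\<close> are the projections of a product \<open>P\<close> of \<open>G\<close> and \<open>A\<close>, and \<open>\<psi>\<close> is a formula
  over \<open>P\<close>. The arrow \<open>s\<close> is \<open>\<langle>id\<^sub>G, a\<rangle>\<close>.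
\<close>

definition interprets_exists ::
  "('o, 'm) category_data \<Rightarrow> 'm \<Rightarrow> 'm \<Rightarrow> 'm \<Rightarrow> bool" where
  "interprets_exists C \<pi> \<psi> \<phi> \<longleftrightarrow> is_image C (\<pi> \<cdot>\<^bsub>C\<^esub> \<psi>) \<phi>"

definition interprets_subst ::
  "('o, 'm) category_data \<Rightarrow> 'm \<Rightarrow> 'm \<Rightarrow> 'm \<Rightarrow> 'm \<Rightarrow> 'm \<Rightarrow> bool" where
  "interprets_subst C \<pi> q \<psi> a \<phi> \<longleftrightarrow>
     (\<exists>s \<in> hom C (Cod C \<pi>) (Dom C \<pi>). \<exists>k.
        \<pi> \<cdot>\<^bsub>C\<^esub> s = Ide C (Cod C \<pi>) \<and> q \<cdot>\<^bsub>C\<^esub> s = a \<and> is_pullback C \<phi> k s \<psi>)"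

text \<open>
  A context is a list \<open>As\<close> of objects, interpreted by a product \<open>G\<close> of \<open>As\<close>. The
  non-initiality condition concerns the entries of \<open>As\<close>, not \<open>G\<close>: a product of
  non-initial objects may be initial. Quantifying over all products, images and pullbacks
  (all of which exist in an elementary topos) makes the notion independent of choices.
\<close>

definition full_epsilon_calculus :: "('o, 'm) category_data \<Rightarrow> bool" where
  "full_epsilon_calculus C \<longleftrightarrow>
     (\<forall>As G ps A P \<pi> q \<psi>.
        set As \<subseteq> Obj C \<and> (\<forall>B \<in> set As. \<not> initial C B) \<and> is_list_product C As G ps \<and>
        A \<in> Obj C \<and> \<not> initial C A \<and> is_binprod C G A P \<pi> q \<and> is_formula C P \<psi> \<longrightarrow>
        (\<exists>\<epsilon> \<in> hom C G A. \<forall>\<phi> \<phi>'.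
           interprets_exists C \<pi> \<psi> \<phi> \<and> interprets_subst C \<pi> q \<psi> \<epsilon> \<phi>' \<longrightarrow>
           derivable C G \<phi> \<phi>'))"

section \<open>Epsilon toposes\<close>

definition axiom_of_choice :: "('o, 'm) category_data \<Rightarrow> bool" where
  "axiom_of_choice C \<longleftrightarrow>
     (\<forall>e. epic C e \<longrightarrow>
        (\<exists>s \<in> hom C (Cod C e) (Dom C e). e \<cdot>\<^bsub>C\<^esub> s = Ide C (Cod C e)))"

definition epsilon_topos :: "('o, 'm) category_data \<Rightarrow> bool" where
  "epsilon_topos C \<longleftrightarrow> elementary_topos C \<and> axiom_of_choice C \<and>
     (\<forall>A \<in> Obj C. \<not> initial C A \<longrightarrow>
        (\<forall>T. terminal C T \<longrightarrow> (\<forall>f \<in> hom C A T. epic C f)))"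

end

theory Submission
  imports Defs
begin

text \<open>
  From the full \<open>\<epsilon>\<close>-calculus, a section of an epimorphism \<open>e : X \<rightarrow> Y\<close> is the \<open>\<epsilon>\<close>-term of the graph of
  \<open>e\<close> in context \<open>y : Y\<close> (if \<open>X\<close> or \<open>Y\<close> is initial, \<open>e\<close> splits anyway), and in the empty context the
  true formula on \<open>A\<close> yields a point of \<open>A\<close>.

  Conversely, given \<open>\<psi> : X \<rightarrow> G \<times> A\<close>, choice splits \<open>X\<close> over its image \<open>I\<close> in \<open>G\<close>, which gives a
  witness \<open>g : I \<rightarrow> A\<close>. A non-initial \<open>A\<close> has a point \<open>a\<close>. Extending \<open>g\<close> to \<open>G\<close> means choosing from
  \<open>{(x, y). x \<in> I \<longrightarrow> y = g x}\<close>, whose projection to \<open>G\<close> has \<open>\<not>\<not>\<close>-dense image, as it contains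
  \<open>(x, g x)\<close> for \<open>x \<in> I\<close> and \<open>(x, a)\<close> for \<open>x \<notin> I\<close>. By Diaconescu's theorem \<open>\<not>\<not>\<close>-dense monomorphisms
  are invertible.

  Since only limits, exponentials and \<open>\<Omega>\<close> are given, the constructions of the internal logic
  (in particular images) are carried out in Kripke--Joyal style, on predicates of generalized elements.
\<close>

section \<open>Categories\<close>

context category
begin

lemma in_hom [simp]: "f \<in> hom C A B \<longleftrightarrow> f \<in> Arr C \<and> Dom C f = A \<and> Cod C f = B"
  by (auto simp: hom_def)

declare Dom_Obj [simp] Cod_Obj [simp]

lemma Ide_simps [simp]:
  assumes "A \<in> Obj C"
  shows "Ide C A \<in> Arr C" "Dom C (Ide C A) = A" "Cod C (Ide C A) = A"
  using Ide_hom[OF assms] by auto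

lemma Comp_simps [simp]:
  assumes "f \<in> Arr C" "g \<in> Arr C" "Cod C f = Dom C g"
  shows "g \<cdot> f \<in> Arr C" "Dom C (g \<cdot> f) = Dom C f" "Cod C (g \<cdot> f) = Cod C g"
  using Comp_hom[of f "Dom C f" "Dom C g" g "Cod C g"] assms by auto

lemma Comp_Ide' [simp]: "f \<in> Arr C \<Longrightarrow> Dom C f = A \<Longrightarrow> f \<cdot> Ide C A = f"
  using Comp_Ide[of f A "Cod C f"] by auto

lemma Ide_Comp' [simp]: "f \<in> Arr C \<Longrightarrow> Cod C f = A \<Longrightarrow> Ide C A \<cdot> f = f"
  using Ide_Comp[of f "Dom C f" A] by auto

lemma assoc [simp]:
  "f \<in> Arr C \<Longrightarrow> g \<in> Arr C \<Longrightarrow> h \<in> Arr C \<Longrightarrow> Cod C f = Dom C g \<Longrightarrow> Cod C g = Dom C h \<Longrightarrow>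
   (h \<cdot> g) \<cdot> f = h \<cdot> (g \<cdot> f)"
  using Comp_assoc[of f "Dom C f" "Dom C g" g "Dom C h" h "Cod C h"] by auto

text \<open>Simplification nests composites to the right, so an equation for
  \<open>g \<cdot> f\<close> no longer matches inside \<open>g \<cdot> f \<cdot> h\<close>; this
  form lets it be used there.\<close>

lemma comp_cong_right:
  assumes "g \<cdot> f = k" "f \<in> Arr C" "g \<in> Arr C" "h \<in> Arr C" "Cod C f = Dom C g" "Cod C h = Dom C f"
  shows "g \<cdot> f \<cdot> h = k \<cdot> h"
  using assms assoc[of h f g] by simp

lemma monicI:
  assumes "m \<in> Arr C"
    and "\<And>f g. f \<in> Arr C \<Longrightarrow> g \<in> Arr C \<Longrightarrow> Dom C f = Dom C g \<Longrightarrow> Cod C f = Dom C m \<Longrightarrow>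
           Cod C g = Dom C m \<Longrightarrow> m \<cdot> f = m \<cdot> g \<Longrightarrow> f = g"
  shows "monic C m"
  unfolding monic_def using assms by auto

lemma monicD:
  assumes "monic C m" "f \<in> Arr C" "g \<in> Arr C" "Dom C f = Dom C g" "Cod C f = Dom C m"
    "Cod C g = Dom C m" "m \<cdot> f = m \<cdot> g"
  shows "f = g"
  using assms unfolding monic_def by auto

lemma monic_Arr [simp]: "monic C m \<Longrightarrow> m \<in> Arr C"
  unfolding monic_def by auto

lemma epicI:
  assumes "e \<in> Arr C"
    and "\<And>f g. f \<in> Arr C \<Longrightarrow> g \<in> Arr C \<Longrightarrow> Dom C f = Cod C e \<Longrightarrow> Dom C g = Cod C e \<Longrightarrow>
           Cod C f = Cod C g \<Longrightarrow> f \<cdot> e = g \<cdot> e \<Longrightarrow> f = g"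
  shows "epic C e"
  unfolding epic_def using assms by auto

lemma epicD:
  assumes "epic C e" "f \<in> Arr C" "g \<in> Arr C" "Dom C f = Cod C e" "Dom C g = Cod C e"
    "Cod C f = Cod C g" "f \<cdot> e = g \<cdot> e"
  shows "f = g"
  using assms unfolding epic_def by auto

lemma monic_comp:
  assumes "monic C m" "monic C n" "Cod C m = Dom C n"
  shows "monic C (n \<cdot> m)"
proof (rule monicI)
  show "n \<cdot> m \<in> Arr C" using assms by simp
next
  fix f g
  assume a: "f \<in> Arr C" "g \<in> Arr C" "Dom C f = Dom C g" "Cod C f = Dom C (n \<cdot> m)"
    "Cod C g = Dom C (n \<cdot> m)" "(n \<cdot> m) \<cdot> f = (n \<cdot> m) \<cdot> g"
  then have "m \<cdot> f = m \<cdot> g" using assms by - (rule monicD[OF assms(2)], auto)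
  then show "f = g" using assms a by - (rule monicD[OF assms(1)], auto)
qed

lemma split_monic:
  assumes "r \<cdot> m = Ide C (Dom C m)" "m \<in> Arr C" "r \<in> Arr C" "Dom C r = Cod C m"
  shows "monic C m"
proof (rule monicI[OF assms(2)])
  fix f g
  assume a: "f \<in> Arr C" "g \<in> Arr C" "Dom C f = Dom C g" "Cod C f = Dom C m"
    "Cod C g = Dom C m" "m \<cdot> f = m \<cdot> g"
  have "(r \<cdot> m) \<cdot> f = (r \<cdot> m) \<cdot> g" using a(1-6) assms(2-4) by simp
  then show "f = g" using a(1-5) unfolding assms(1) by simp
qed

lemma split_epic:
  assumes "e \<cdot> s = Ide C (Cod C e)" "e \<in> Arr C" "s \<in> Arr C" "Cod C s = Dom C e" "Dom C s = Cod C e"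
  shows "epic C e"
proof (rule epicI[OF assms(2)])
  fix f g
  assume a: "f \<in> Arr C" "g \<in> Arr C" "Dom C f = Cod C e" "Dom C g = Cod C e"
    "Cod C f = Cod C g" "f \<cdot> e = g \<cdot> e"
  have "(f \<cdot> e) \<cdot> s = (g \<cdot> e) \<cdot> s" by (simp only: a(6))
  then have "f \<cdot> (e \<cdot> s) = g \<cdot> (e \<cdot> s)" using a(1-5) assms(2-5) by simp
  then show "f = g" using a(1-5) unfolding assms(1) by simp
qed

lemma choice_section:
  assumes "axiom_of_choice C" "epic C e"
  obtains s where "s \<in> Arr C" "Dom C s = Cod C e" "Cod C s = Dom C e" "e \<cdot> s = Ide C (Cod C e)"
proof -
  have "\<exists>s \<in> hom C (Cod C e) (Dom C e). e \<cdot> s = Ide C (Cod C e)"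
    using assms unfolding axiom_of_choice_def by blast
  then show ?thesis using that by auto
qed

section \<open>Factorizations, binary products and pullbacks\<close>

lemma factors_throughI:
  "h \<in> Arr C \<Longrightarrow> Dom C h = Dom C f \<Longrightarrow> Cod C h = Dom C m \<Longrightarrow> m \<cdot> h = f \<Longrightarrow> factors_through C f m"
  unfolding factors_through_def by auto

lemma factors_throughE:
  assumes "factors_through C f m"
  obtains h where "h \<in> Arr C" "Dom C h = Dom C f" "Cod C h = Dom C m" "m \<cdot> h = f"
  using assms unfolding factors_through_def by auto

lemma factors_through_trans:
  assumes "factors_through C f m" "factors_through C m n" "m \<in> Arr C" "n \<in> Arr C" "Cod C m = Cod C n"
  shows "factors_through C f n"
proof -
  obtain h where h: "h \<in> Arr C" "Dom C h = Dom C f" "Cod C h = Dom C m" "m \<cdot> h = f"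
    by (rule factors_throughE[OF assms(1)])
  obtain k where k: "k \<in> Arr C" "Dom C k = Dom C m" "Cod C k = Dom C n" "n \<cdot> k = m"
    by (rule factors_throughE[OF assms(2)])
  show ?thesis
    using h k assms comp_cong_right[OF k(4), of h] by - (rule factors_throughI[of "k \<cdot> h"], auto)
qed

lemma factors_through_comp:
  assumes "factors_through C f m" "m \<in> Arr C" "t \<in> Arr C" "Cod C t = Dom C f"
  shows "factors_through C (f \<cdot> t) m"
proof -
  obtain h where h: "h \<in> Arr C" "Dom C h = Dom C f" "Cod C h = Dom C m" "m \<cdot> h = f"
    by (rule factors_throughE[OF assms(1)])
  then have "f \<in> Arr C" using Comp_simps(1)[of h m] assms(2) by auto
  then show ?thesis
    using h assms comp_cong_right[OF h(4), of t] by - (rule factors_throughI[of "h \<cdot> t"], auto)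
qed

lemma factors_through_refl: "m \<in> Arr C \<Longrightarrow> factors_through C m m"
  by - (rule factors_throughI[of "Ide C (Dom C m)"], auto)

lemma binprod_simps:
  assumes "is_binprod C A B P p q"
  shows "p \<in> Arr C" "q \<in> Arr C" "Dom C p = P" "Dom C q = P" "Cod C p = A" "Cod C q = B"
  using assms unfolding is_binprod_def by auto

lemma binprod_pair:
  assumes "is_binprod C A B P p q" "f \<in> Arr C" "g \<in> Arr C" "Dom C f = X" "Dom C g = X"
    "Cod C f = A" "Cod C g = B"
  obtains h where "h \<in> Arr C" "Dom C h = X" "Cod C h = P" "p \<cdot> h = f" "q \<cdot> h = g"
proof -
  have "f \<in> hom C X A" "g \<in> hom C X B" using assms by auto
  then have "\<exists>!h. h \<in> hom C X P \<and> p \<cdot> h = f \<and> q \<cdot> h = g"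
    using assms(1) unfolding is_binprod_def by blast
  then show ?thesis using that by auto
qed

lemma binprod_eqI:
  assumes "is_binprod C A B P p q" "h \<in> Arr C" "k \<in> Arr C" "Dom C h = Dom C k" "Cod C h = P"
    "Cod C k = P" "p \<cdot> h = p \<cdot> k" "q \<cdot> h = q \<cdot> k"
  shows "h = k"
proof -
  note pq = binprod_simps[OF assms(1)]
  have "p \<cdot> k \<in> hom C (Dom C k) A" "q \<cdot> k \<in> hom C (Dom C k) B" using assms pq by auto
  then have "\<exists>!l. l \<in> hom C (Dom C k) P \<and> p \<cdot> l = p \<cdot> k \<and> q \<cdot> l = q \<cdot> k"
    using assms(1) unfolding is_binprod_def by blast
  then show ?thesis using assms by auto
qed

lemma pullback_simps:
  assumes "is_pullback C p q f g"
  shows "p \<in> Arr C" "q \<in> Arr C" "f \<in> Arr C" "g \<in> Arr C" "Cod C f = Cod C g" "Dom C q = Dom C p"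
    "Cod C p = Dom C f" "Cod C q = Dom C g" "f \<cdot> p = g \<cdot> q"
  using assms unfolding is_pullback_def by auto

lemma pullback_lift:
  assumes "is_pullback C p q f g" "u \<in> Arr C" "v \<in> Arr C" "Dom C u = Dom C v"
    "Cod C u = Dom C f" "Cod C v = Dom C g" "f \<cdot> u = g \<cdot> v"
  obtains h where "h \<in> Arr C" "Dom C h = Dom C u" "Cod C h = Dom C p" "p \<cdot> h = u" "q \<cdot> h = v"
proof -
  have "u \<in> hom C (Dom C u) (Dom C f)" "v \<in> hom C (Dom C u) (Dom C g)" using assms by auto
  then have "\<exists>!h. h \<in> hom C (Dom C u) (Dom C p) \<and> p \<cdot> h = u \<and> q \<cdot> h = v"
    using assms(1,7) unfolding is_pullback_def by blast
  then show ?thesis using that by auto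
qed

lemma pullback_eqI:
  assumes "is_pullback C p q f g" "h \<in> Arr C" "k \<in> Arr C" "Dom C h = Dom C k" "Cod C h = Dom C p"
    "Cod C k = Dom C p" "p \<cdot> h = p \<cdot> k" "q \<cdot> h = q \<cdot> k"
  shows "h = k"
proof -
  note pq = pullback_simps[OF assms(1)]
  have uv: "p \<cdot> k \<in> hom C (Dom C k) (Dom C f)" "q \<cdot> k \<in> hom C (Dom C k) (Dom C g)"
    using assms pq by auto
  have "f \<cdot> p \<cdot> k = g \<cdot> q \<cdot> k"
    using comp_cong_right[OF pq(9), of k] pq assms by simp
  with uv have "\<exists>!l. l \<in> hom C (Dom C k) (Dom C p) \<and> p \<cdot> l = p \<cdot> k \<and> q \<cdot> l = q \<cdot> k"
    using assms(1) unfolding is_pullback_def by blast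
  then show ?thesis using assms by auto
qed

lemma pullback_monic:
  assumes "is_pullback C p q f g" "monic C g"
  shows "monic C p"
proof (rule monicI)
  note pq [simp] = pullback_simps[OF assms(1)]
  show "p \<in> Arr C" by simp
  fix h k
  assume a: "h \<in> Arr C" "k \<in> Arr C" "Dom C h = Dom C k" "Cod C h = Dom C p"
    "Cod C k = Dom C p" "p \<cdot> h = p \<cdot> k"
  have "f \<cdot> p \<cdot> h = g \<cdot> q \<cdot> h" "f \<cdot> p \<cdot> k = g \<cdot> q \<cdot> k"
    using a(1-5) comp_cong_right[OF pq(9), of h] comp_cong_right[OF pq(9), of k] by simp_all
  then have gq: "g \<cdot> q \<cdot> h = g \<cdot> q \<cdot> k" using a(6) by metis
  have "q \<cdot> h = q \<cdot> k" by (rule monicD[OF assms(2)]) (simp_all add: a(1-5) gq)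
  then show "h = k" using a by - (rule pullback_eqI[OF assms(1)], auto)
qed

end

section \<open>Classified predicates\<close>

locale topos = category C for C :: "('o, 'm) category_data" (structure) +
  fixes one \<Omega> tr
  assumes finitely_complete: "finitely_complete C"
    and cartesian_closed: "cartesian_closed C"
    and classifier: "is_subobject_classifier C one \<Omega> tr"
begin

section \<open>The terminal object and truth at a stage\<close>

lemma terminal_one: "terminal C one"
  using classifier unfolding is_subobject_classifier_def by blast

lemma one_Obj [simp]: "one \<in> Obj C"
  using terminal_one unfolding terminal_def by blast

lemma tr_simps [simp]: "tr \<in> Arr C" "Dom C tr = one" "Cod C tr = \<Omega>"
  using classifier unfolding is_subobject_classifier_def by auto

lemma \<Omega>_Obj [simp]: "\<Omega> \<in> Obj C"
  using Cod_Obj[of tr] by simp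

lemma to_one_unique:
  assumes "f \<in> Arr C" "g \<in> Arr C" "Dom C f = Dom C g" "Cod C f = one" "Cod C g = one"
  shows "f = g"
proof -
  have "\<exists>!h. h \<in> hom C (Dom C g) one"
    using terminal_one assms unfolding terminal_def by auto
  then show ?thesis using assms by auto
qed

definition bang :: "'o \<Rightarrow> 'm" where
  "bang X = (THE f. f \<in> hom C X one)"

lemma bang_simps [simp]:
  assumes "X \<in> Obj C"
  shows "bang X \<in> Arr C" "Dom C (bang X) = X" "Cod C (bang X) = one"
proof -
  have "\<exists>!f. f \<in> hom C X one"
    using terminal_one assms unfolding terminal_def by blast
  then have "bang X \<in> hom C X one" unfolding bang_def by (rule theI')
  then show "bang X \<in> Arr C" "Dom C (bang X) = X" "Cod C (bang X) = one" by auto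
qed

text \<open>In the Kripke--Joyal reading, a truth value \<open>w : X \<rightarrow> \<Omega>\<close>
  is forced at stage \<open>X\<close> when it equals this arrow.\<close>

definition true_at :: "'o \<Rightarrow> 'm" where
  "true_at X = tr \<cdot> bang X"

lemma true_at_simps [simp]:
  assumes "X \<in> Obj C"
  shows "true_at X \<in> Arr C" "Dom C (true_at X) = X" "Cod C (true_at X) = \<Omega>"
  using assms unfolding true_at_def by auto

lemma tr_comp: "u \<in> Arr C \<Longrightarrow> Cod C u = one \<Longrightarrow> tr \<cdot> u = true_at (Dom C u)"
  unfolding true_at_def using to_one_unique[of u "bang (Dom C u)"] by simp

lemma true_at_comp [simp]:
  assumes "t \<in> Arr C" "Cod C t = X"
  shows "true_at X \<cdot> t = true_at (Dom C t)"
proof -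
  have X: "X \<in> Obj C" using assms by auto
  then have "true_at X \<cdot> t = tr \<cdot> (bang X \<cdot> t)" using assms unfolding true_at_def by simp
  also have "\<dots> = true_at (Dom C t)" using assms X tr_comp[of "bang X \<cdot> t"] by simp
  finally show ?thesis .
qed

section \<open>Limits, exponentials and predicates with a classifying arrow\<close>

lemma pullback_exists:
  assumes "f \<in> Arr C" "g \<in> Arr C" "Cod C f = Cod C g"
  obtains p q where "is_pullback C p q f g"
  using finitely_complete assms unfolding finitely_complete_def by blast

lemma binprod_exists:
  assumes "A \<in> Obj C" "B \<in> Obj C"
  obtains P p q where "is_binprod C A B P p q"
  using cartesian_closed assms unfolding cartesian_closed_def by blast

lemma exponential_exists:
  assumes "A \<in> Obj C" "B \<in> Obj C"
  obtains E P p q ev where "is_exponential C A B E P p q ev"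
  using cartesian_closed assms unfolding cartesian_closed_def by blast

text \<open>\<open>S\<close> is the forcing relation of the internal formula \<chi>. On elements of
  \<open>G\<close> it is therefore automatically stable under change of stage, and the logical
  operations can be stated on HOL predicates rather than on arrows.\<close>

definition classifies :: "'m \<Rightarrow> 'o \<Rightarrow> ('m \<Rightarrow> bool) \<Rightarrow> bool" where
  "classifies \<chi> G S \<longleftrightarrow> \<chi> \<in> Arr C \<and> Dom C \<chi> = G \<and> Cod C \<chi> = \<Omega> \<and>
     (\<forall>x \<in> Arr C. Cod C x = G \<longrightarrow> (\<chi> \<cdot> x = true_at (Dom C x) \<longleftrightarrow> S x))"

lemma classifies_simps:
  assumes "classifies \<chi> G S"
  shows "\<chi> \<in> Arr C" "Dom C \<chi> = G" "Cod C \<chi> = \<Omega>" "G \<in> Obj C"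
  using assms unfolding classifies_def by auto

lemma classifiesD:
  "classifies \<chi> G S \<Longrightarrow> x \<in> Arr C \<Longrightarrow> Cod C x = G \<Longrightarrow> \<chi> \<cdot> x = true_at (Dom C x) \<longleftrightarrow> S x"
  unfolding classifies_def by blast

lemma classifies_cong:
  assumes "classifies \<chi> G S" "\<And>x. x \<in> Arr C \<Longrightarrow> Cod C x = G \<Longrightarrow> S x \<longleftrightarrow> S' x"
  shows "classifies \<chi> G S'"
  using assms unfolding classifies_def by auto

lemma classify_comp:
  assumes "classifies \<chi> H S" "f \<in> Arr C" "Dom C f = G" "Cod C f = H"
  shows "classifies (\<chi> \<cdot> f) G (\<lambda>x. S (f \<cdot> x))"
proof -
  note [simp] = classifies_simps[OF assms(1)] assms(2-4)
  have "(\<chi> \<cdot> f) \<cdot> x = true_at (Dom C x) \<longleftrightarrow> S (f \<cdot> x)" if "x \<in> Arr C" "Cod C x = G" for x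
    using that classifiesD[OF assms(1), of "f \<cdot> x"] by simp
  then show ?thesis unfolding classifies_def by simp
qed

lemma classifies_self:
  assumes "\<chi> \<in> Arr C" "Cod C \<chi> = \<Omega>"
  shows "classifies \<chi> (Dom C \<chi>) (\<lambda>x. \<chi> \<cdot> x = true_at (Dom C x))"
  using assms unfolding classifies_def by auto

text \<open>Pulling \<open>tr\<close> back along \<chi> gives the subobject of those elements that
  satisfy \<open>S\<close>.\<close>

lemma comprehension:
  assumes "classifies \<chi> G S"
  obtains m where "monic C m" "Cod C m = G"
    "\<And>x. x \<in> Arr C \<Longrightarrow> Cod C x = G \<Longrightarrow> factors_through C x m \<longleftrightarrow> S x"
proof -
  note [simp] = classifies_simps[OF assms]
  obtain m u where pb: "is_pullback C m u \<chi> tr"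
    using pullback_exists[of \<chi> tr] by auto
  note pbs [simp] = pullback_simps[OF pb]
  have "monic C tr" by (rule monicI) (simp_all add: to_one_unique)
  then have m: "monic C m" by (rule pullback_monic[OF pb])
  have "factors_through C x m \<longleftrightarrow> S x" if x: "x \<in> Arr C" "Cod C x = G" for x
  proof
    assume "factors_through C x m"
    then obtain h where h: "h \<in> Arr C" "Dom C h = Dom C x" "Cod C h = Dom C m" "m \<cdot> h = x"
      by (rule factors_throughE)
    have "\<chi> \<cdot> x = tr \<cdot> (u \<cdot> h)" using comp_cong_right[OF pbs(9), of h] h by simp
    then show "S x" using classifiesD[OF assms x] tr_comp[of "u \<cdot> h"] h by simp
  next
    assume "S x"
    then have "\<chi> \<cdot> x = tr \<cdot> bang (Dom C x)"
      using classifiesD[OF assms x] unfolding true_at_def by simp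
    then obtain h where "h \<in> Arr C" "Dom C h = Dom C x" "Cod C h = Dom C m" "m \<cdot> h = x"
      using x pullback_lift[OF pb, of x "bang (Dom C x)"] by auto
    then show "factors_through C x m" by (rule factors_throughI)
  qed
  then show ?thesis using that[OF m] by simp
qed

text \<open>Recovers the pullback square from a description by elements: lifts exist by hypothesis,
  are unique because \<open>m\<close> is monic, and the leg into \<open>one\<close> commutes by
  terminality. This makes the uniqueness clause of the classifier applicable.\<close>

lemma monic_pullback_tr:
  assumes "monic C m" "\<chi> \<in> Arr C" "Cod C \<chi> = \<Omega>" "Dom C \<chi> = Cod C m"
    and "\<And>x. x \<in> Arr C \<Longrightarrow> Cod C x = Cod C m \<Longrightarrow>
           factors_through C x m \<longleftrightarrow> \<chi> \<cdot> x = true_at (Dom C x)"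
  shows "is_pullback C m (bang (Dom C m)) \<chi> tr"
proof -
  have m [simp]: "m \<in> Arr C" using assms by simp
  have eq: "\<chi> \<cdot> m = tr \<cdot> bang (Dom C m)"
    using assms(5)[of m] factors_through_refl[OF m] unfolding true_at_def by simp
  have "\<exists>!h. h \<in> hom C X (Dom C m) \<and> m \<cdot> h = u \<and> bang (Dom C m) \<cdot> h = v"
    if uv: "u \<in> hom C X (Dom C \<chi>)" "v \<in> hom C X (Dom C tr)" "\<chi> \<cdot> u = tr \<cdot> v" for X u v
  proof -
    have "\<chi> \<cdot> u = true_at (Dom C u)" using uv tr_comp[of v] by simp
    then obtain h where h: "h \<in> Arr C" "Dom C h = Dom C u" "Cod C h = Dom C m" "m \<cdot> h = u"
      using assms(4) assms(5)[of u] uv by (auto elim!: factors_throughE)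
    have "bang (Dom C m) \<cdot> h = v" using h uv by - (rule to_one_unique, auto)
    have "h' = h" if "h' \<in> hom C X (Dom C m)" "m \<cdot> h' = u" for h'
      using that h uv by - (rule monicD[OF assms(1)], auto)
    moreover have "h \<in> hom C X (Dom C m)" using h uv by simp
    ultimately show ?thesis using h(4) \<open>bang (Dom C m) \<cdot> h = v\<close> by blast
  qed
  note lift = this
  have hom: "m \<in> hom C (Dom C m) (Dom C \<chi>)" "bang (Dom C m) \<in> hom C (Dom C m) (Dom C tr)"
    using assms(4) by simp_all
  show ?thesis
    unfolding is_pullback_def
    by (intro conjI allI ballI impI lift hom eq) (simp_all add: assms(2,3))
qed

text \<open>Propositional extensionality: arrows into \<Omega> that are forced at the same stages
  both classify the subobject cut out by \<open>a\<close>, and classifying arrows are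
  unique.\<close>

lemma \<Omega>_ext:
  assumes "a \<in> Arr C" "b \<in> Arr C" "Dom C a = Dom C b" "Cod C a = \<Omega>" "Cod C b = \<Omega>"
    and "\<And>x. x \<in> Arr C \<Longrightarrow> Cod C x = Dom C a \<Longrightarrow>
           a \<cdot> x = true_at (Dom C x) \<longleftrightarrow> b \<cdot> x = true_at (Dom C x)"
  shows "a = b"
proof -
  obtain m where m: "monic C m" "Cod C m = Dom C a"
    "\<And>x. x \<in> Arr C \<Longrightarrow> Cod C x = Dom C a \<Longrightarrow> factors_through C x m \<longleftrightarrow> a \<cdot> x = true_at (Dom C x)"
    using comprehension[OF classifies_self[OF assms(1,4)]] by metis
  have "is_pullback C m (bang (Dom C m)) a tr" "is_pullback C m (bang (Dom C m)) b tr"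
    using m assms by (auto intro!: monic_pullback_tr)
  moreover have "bang (Dom C m) \<in> hom C (Dom C m) one"
    "a \<in> hom C (Cod C m) \<Omega>" "b \<in> hom C (Cod C m) \<Omega>" using m assms by simp_all
  moreover have "\<exists>!\<chi>. \<chi> \<in> hom C (Cod C m) \<Omega> \<and> (\<exists>u \<in> hom C (Dom C m) one. is_pullback C m u \<chi> tr)"
    using classifier m(1) unfolding is_subobject_classifier_def by blast
  ultimately show ?thesis by blast
qed

lemma classify_monic:
  assumes "monic C m"
  obtains \<chi> where "classifies \<chi> (Cod C m) (\<lambda>x. factors_through C x m)"
proof -
  have m [simp]: "m \<in> Arr C" using assms by simp
  have "\<exists>!\<chi>. \<chi> \<in> hom C (Cod C m) \<Omega> \<and> (\<exists>u \<in> hom C (Dom C m) one. is_pullback C m u \<chi> tr)"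
    using classifier assms(1) unfolding is_subobject_classifier_def by blast
  then obtain \<chi> u where c: "\<chi> \<in> Arr C" "Dom C \<chi> = Cod C m" "Cod C \<chi> = \<Omega>" "u \<in> Arr C"
    "Dom C u = Dom C m" "Cod C u = one" and pb: "is_pullback C m u \<chi> tr" by auto
  have "\<chi> \<cdot> x = true_at (Dom C x) \<longleftrightarrow> factors_through C x m"
    if x: "x \<in> Arr C" "Cod C x = Cod C m" for x
  proof
    assume "factors_through C x m"
    then obtain h where h: "h \<in> Arr C" "Dom C h = Dom C x" "Cod C h = Dom C m" "m \<cdot> h = x"
      by (rule factors_throughE)
    have "\<chi> \<cdot> x = tr \<cdot> (u \<cdot> h)" using comp_cong_right[OF pullback_simps(9)[OF pb], of h] h c by simp
    then show "\<chi> \<cdot> x = true_at (Dom C x)" using tr_comp[of "u \<cdot> h"] h c by simp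
  next
    assume "\<chi> \<cdot> x = true_at (Dom C x)"
    then obtain h where "h \<in> Arr C" "Dom C h = Dom C x" "Cod C h = Dom C m" "m \<cdot> h = x"
      using x c pullback_lift[OF pb, of x "bang (Dom C x)"] by (auto simp: true_at_def)
    then show "factors_through C x m" by (rule factors_throughI)
  qed
  then have "classifies \<chi> (Cod C m) (\<lambda>x. factors_through C x m)"
    unfolding classifies_def using c by auto
  then show ?thesis by (rule that)
qed

text \<open>The equalizer is the pullback of the graphs of \<open>f\<close> and \<open>g\<close>:
  the first coordinates force both legs of the pullback to coincide, the second ones then say that
  \<open>f\<close> and \<open>g\<close> agree.\<close>

lemma equalizer_exists:
  assumes f: "f \<in> Arr C" "Dom C f = A" "Cod C f = B" and g: "g \<in> Arr C" "Dom C g = A" "Cod C g = B"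
  obtains m where "monic C m" "Cod C m = A"
    "\<And>x. x \<in> Arr C \<Longrightarrow> Cod C x = A \<Longrightarrow> factors_through C x m \<longleftrightarrow> f \<cdot> x = g \<cdot> x"
proof -
  have AB: "A \<in> Obj C" "B \<in> Obj C" using f by auto
  obtain P p q where bp: "is_binprod C A B P p q" using binprod_exists[OF AB] .
  note [simp] = binprod_simps[OF bp] AB f g
  obtain f' where f': "f' \<in> Arr C" "Dom C f' = A" "Cod C f' = P" "p \<cdot> f' = Ide C A" "q \<cdot> f' = f"
    using binprod_pair[OF bp, of "Ide C A" f A] by auto
  obtain g' where g': "g' \<in> Arr C" "Dom C g' = A" "Cod C g' = P" "p \<cdot> g' = Ide C A" "q \<cdot> g' = g"
    using binprod_pair[OF bp, of "Ide C A" g A] by auto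
  note [simp] = f'(1-3) g'(1-3)
  obtain m k where pb: "is_pullback C m k f' g'" using pullback_exists[of f' g'] by auto
  note pbs [simp] = pullback_simps[OF pb]
  have g'm: "monic C g'" using g' by (intro split_monic[of p]) auto
  have eq: "f' \<cdot> x = g' \<cdot> y \<longleftrightarrow> x = y \<and> f \<cdot> x = g \<cdot> x"
    if xy: "x \<in> Arr C" "Cod C x = A" "y \<in> Arr C" "Cod C y = A" "Dom C y = Dom C x" for x y
  proof -
    have e: "p \<cdot> f' \<cdot> x = x" "q \<cdot> f' \<cdot> x = f \<cdot> x" "p \<cdot> g' \<cdot> y = y" "q \<cdot> g' \<cdot> y = g \<cdot> y"
      using xy comp_cong_right[OF f'(4), of x] comp_cong_right[OF f'(5), of x]
        comp_cong_right[OF g'(4), of y] comp_cong_right[OF g'(5), of y] by auto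
    show ?thesis
    proof
      assume h: "f' \<cdot> x = g' \<cdot> y"
      have "x = y" using e(1,3) h by simp
      then show "x = y \<and> f \<cdot> x = g \<cdot> x" using e(2,4) h by simp
    next
      assume "x = y \<and> f \<cdot> x = g \<cdot> x"
      then show "f' \<cdot> x = g' \<cdot> y" using xy e by - (rule binprod_eqI[OF bp], auto)
    qed
  qed
  have mk: "m = k" "f \<cdot> m = g \<cdot> m" using eq[of m k] pbs(9) by auto
  have "factors_through C x m \<longleftrightarrow> f \<cdot> x = g \<cdot> x" if x: "x \<in> Arr C" "Cod C x = A" for x
  proof
    assume "factors_through C x m"
    then obtain h where h: "h \<in> Arr C" "Dom C h = Dom C x" "Cod C h = Dom C m" "m \<cdot> h = x"
      by (rule factors_throughE)
    then show "f \<cdot> x = g \<cdot> x" using comp_cong_right[OF mk(2), of h] by simp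
  next
    assume "f \<cdot> x = g \<cdot> x"
    then obtain h where "h \<in> Arr C" "Dom C h = Dom C x" "Cod C h = Dom C m" "m \<cdot> h = x"
      using pullback_lift[OF pb, of x x] x eq[of x x] by auto
    then show "factors_through C x m" by (rule factors_throughI)
  qed
  then show ?thesis using that[OF pullback_monic[OF pb g'm]] by simp
qed

section \<open>Equality, conjunction and implication\<close>

lemma classify_eq:
  assumes f: "f \<in> Arr C" "Dom C f = A" "Cod C f = B" and g: "g \<in> Arr C" "Dom C g = A" "Cod C g = B"
  obtains \<chi> where "classifies \<chi> A (\<lambda>x. f \<cdot> x = g \<cdot> x)"
proof -
  obtain m where m: "monic C m" "Cod C m = A"
    "\<And>x. x \<in> Arr C \<Longrightarrow> Cod C x = A \<Longrightarrow> factors_through C x m \<longleftrightarrow> f \<cdot> x = g \<cdot> x"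
    using equalizer_exists[OF assms] by metis
  obtain \<chi> where "classifies \<chi> (Cod C m) (\<lambda>x. factors_through C x m)"
    using classify_monic[OF m(1)] .
  then have "classifies \<chi> A (\<lambda>x. f \<cdot> x = g \<cdot> x)"
    using classifies_cong[of \<chi> A _ "\<lambda>x. f \<cdot> x = g \<cdot> x"] m by simp
  then show ?thesis by (rule that)
qed

lemma classify_conj:
  assumes "classifies \<chi> G S" "classifies \<chi>' G S'"
  obtains \<kappa> where "classifies \<kappa> G (\<lambda>x. S x \<and> S' x)"
proof -
  obtain m where m: "monic C m" "Cod C m = G"
    "\<And>x. x \<in> Arr C \<Longrightarrow> Cod C x = G \<Longrightarrow> factors_through C x m \<longleftrightarrow> S x"
    using comprehension[OF assms(1)] by metis
  obtain n where n: "monic C n" "Cod C n = G"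
    "\<And>x. x \<in> Arr C \<Longrightarrow> Cod C x = G \<Longrightarrow> factors_through C x n \<longleftrightarrow> S' x"
    using comprehension[OF assms(2)] by metis
  obtain p q where pb: "is_pullback C p q m n" using pullback_exists[of m n] m n by auto
  note pbs [simp] = pullback_simps[OF pb]
  have mp: "monic C (m \<cdot> p)"
    using monic_comp[OF pullback_monic[OF pb n(1)] m(1)] by simp
  obtain \<kappa> where k: "classifies \<kappa> (Cod C (m \<cdot> p)) (\<lambda>x. factors_through C x (m \<cdot> p))"
    using classify_monic[OF mp] .
  have "factors_through C x (m \<cdot> p) \<longleftrightarrow> S x \<and> S' x" if x: "x \<in> Arr C" "Cod C x = G" for x
  proof
    assume "factors_through C x (m \<cdot> p)"
    then obtain h where h: "h \<in> Arr C" "Dom C h = Dom C x" "Cod C h = Dom C (m \<cdot> p)" "(m \<cdot> p) \<cdot> h = x"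
      by (rule factors_throughE)
    note [simp] = h(1) h(3)[simplified]
    have "n \<cdot> (q \<cdot> h) = x" "m \<cdot> (p \<cdot> h) = x" using h(4) comp_cong_right[OF pbs(9), of h] by simp_all
    then have "factors_through C x n" "factors_through C x m"
      using factors_throughI[of "q \<cdot> h" x n] factors_throughI[of "p \<cdot> h" x m] h(2) by simp_all
    then show "S x \<and> S' x" using m(3) n(3) x by simp
  next
    assume "S x \<and> S' x"
    then have fx: "factors_through C x m" "factors_through C x n" using m(3) n(3) x by auto
    obtain h where h: "h \<in> Arr C" "Dom C h = Dom C x" "Cod C h = Dom C m" "m \<cdot> h = x"
      by (rule factors_throughE[OF fx(1)])
    obtain k where k: "k \<in> Arr C" "Dom C k = Dom C x" "Cod C k = Dom C n" "n \<cdot> k = x"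
      by (rule factors_throughE[OF fx(2)])
    obtain l where l: "l \<in> Arr C" "Dom C l = Dom C h" "Cod C l = Dom C p" "p \<cdot> l = h" "q \<cdot> l = k"
      using pullback_lift[OF pb, of h k] h k by auto
    show "factors_through C x (m \<cdot> p)"
      by (rule factors_throughI[of l]) (simp_all add: l k(4) h(2,4) m(1,2))
  qed
  then have "classifies \<kappa> G (\<lambda>x. S x \<and> S' x)"
    using classifies_cong[OF k, of "\<lambda>x. S x \<and> S' x"] m(2) by simp
  then show ?thesis by (rule that)
qed

text \<open>\<open>S \<longrightarrow> S'\<close> is the equation between \<open>S\<close> and
  \<open>S \<and> S'\<close> in \<Omega>. By extensionality that equation at \<open>x\<close> means
  agreement at all later stages, whence the quantifier over \<open>t\<close>.\<close>

lemma classify_imp: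
  assumes "classifies \<chi> G S" "classifies \<chi>' G S'"
  obtains \<kappa> where
    "classifies \<kappa> G (\<lambda>x. \<forall>t \<in> Arr C. Cod C t = Dom C x \<longrightarrow> S (x \<cdot> t) \<longrightarrow> S' (x \<cdot> t))"
proof -
  obtain \<theta> where t: "classifies \<theta> G (\<lambda>x. S x \<and> S' x)" by (rule classify_conj[OF assms])
  note [simp] = classifies_simps[OF assms(1)] classifies_simps[OF t]
  obtain \<kappa> where k: "classifies \<kappa> G (\<lambda>x. \<chi> \<cdot> x = \<theta> \<cdot> x)"
    using classify_eq[of \<chi> G \<Omega> \<theta>] by auto
  have "\<chi> \<cdot> x = \<theta> \<cdot> x \<longleftrightarrow> (\<forall>t \<in> Arr C. Cod C t = Dom C x \<longrightarrow> S (x \<cdot> t) \<longrightarrow> S' (x \<cdot> t))"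
    if x: "x \<in> Arr C" "Cod C x = G" for x
  proof -
    have iff: "(\<chi> \<cdot> x) \<cdot> t = true_at (Dom C t) \<longleftrightarrow> S (x \<cdot> t)"
      "(\<theta> \<cdot> x) \<cdot> t = true_at (Dom C t) \<longleftrightarrow> S (x \<cdot> t) \<and> S' (x \<cdot> t)"
      if "t \<in> Arr C" "Cod C t = Dom C x" for t
      using that x classifiesD[OF assms(1), of "x \<cdot> t"] classifiesD[OF t, of "x \<cdot> t"] by auto
    show ?thesis
    proof
      assume "\<chi> \<cdot> x = \<theta> \<cdot> x"
      then show "\<forall>t \<in> Arr C. Cod C t = Dom C x \<longrightarrow> S (x \<cdot> t) \<longrightarrow> S' (x \<cdot> t)"
        using iff by auto
    next
      assume "\<forall>t \<in> Arr C. Cod C t = Dom C x \<longrightarrow> S (x \<cdot> t) \<longrightarrow> S' (x \<cdot> t)"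
      then show "\<chi> \<cdot> x = \<theta> \<cdot> x"
        using x iff by - (rule \<Omega>_ext, auto)
    qed
  qed
  then have "classifies \<kappa> G (\<lambda>x. \<forall>t \<in> Arr C. Cod C t = Dom C x \<longrightarrow> S (x \<cdot> t) \<longrightarrow> S' (x \<cdot> t))"
    by (rule classifies_cong[OF k])
  then show ?thesis by (rule that)
qed

section \<open>Exponentials and universal quantification\<close>

lemma exponential_simps:
  assumes "is_exponential C A B E P p q ev"
  shows "is_binprod C E A P p q" "ev \<in> Arr C" "Dom C ev = P" "Cod C ev = B"
  using assms unfolding is_exponential_def by auto

lemma transpose_exists:
  assumes "is_exponential C A B E P p q ev" "is_binprod C X A Q p' q'"
    and "f \<in> Arr C" "Dom C f = Q" "Cod C f = B"
  obtains g h where "g \<in> Arr C" "Dom C g = X" "Cod C g = E" "h \<in> Arr C" "Dom C h = Q" "Cod C h = P"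
    "p \<cdot> h = g \<cdot> p'" "q \<cdot> h = q'" "ev \<cdot> h = f"
proof -
  have "f \<in> hom C Q B" using assms by simp
  then have "\<exists>g. g \<in> hom C X E \<and>
      (\<exists>h \<in> hom C Q P. p \<cdot> h = g \<cdot> p' \<and> q \<cdot> h = q' \<and> ev \<cdot> h = f)"
    using assms(1,2) unfolding is_exponential_def by blast
  then show ?thesis using that by auto
qed

lemma transpose_unique:
  assumes "is_exponential C A B E P p q ev" "is_binprod C X A Q p' q'"
    and "g \<in> Arr C" "Dom C g = X" "Cod C g = E" "h \<in> Arr C" "Dom C h = Q" "Cod C h = P"
    and "p \<cdot> h = g \<cdot> p'" "q \<cdot> h = q'"
    and "k \<in> Arr C" "Dom C k = X" "Cod C k = E" "l \<in> Arr C" "Dom C l = Q" "Cod C l = P"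
    and "p \<cdot> l = k \<cdot> p'" "q \<cdot> l = q'" and "ev \<cdot> h = ev \<cdot> l"
  shows "g = k"
proof -
  have "ev \<cdot> l \<in> hom C Q B" using assms(14-16) exponential_simps[OF assms(1)] by simp
  then have "\<exists>!g. g \<in> hom C X E \<and>
      (\<exists>h \<in> hom C Q P. p \<cdot> h = g \<cdot> p' \<and> q \<cdot> h = q' \<and> ev \<cdot> h = ev \<cdot> l)"
    using assms(1,2) unfolding is_exponential_def by blast
  moreover have "g \<in> hom C X E" "k \<in> hom C X E" "h \<in> hom C Q P" "l \<in> hom C Q P"
    using assms by simp_all
  ultimately show ?thesis using assms(9,10,17-19) by blast
qed

text \<open>The predicate holds on the whole fibre over \<open>x\<close> iff the transposes of
  \<chi> and of constant truth, both \<open>G \<rightarrow> \<Omega>^A\<close>, agree at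
  \<open>x\<close>. So the universal quantifier is again an equality.\<close>

lemma classify_all:
  assumes bp: "is_binprod C G A P p q" and c: "classifies \<chi> P S"
  obtains \<kappa> where "classifies \<kappa> G (\<lambda>x. \<forall>t \<in> Arr C. Cod C t = Dom C x \<longrightarrow>
    (\<forall>y \<in> Arr C. Dom C y = Dom C t \<longrightarrow> Cod C y = P \<longrightarrow> p \<cdot> y = x \<cdot> t \<longrightarrow> S y))"
proof -
  note [simp] = binprod_simps[OF bp] classifies_simps[OF c]
  have A: "A \<in> Obj C" using Cod_Obj[of q] by simp
  obtain E R pE qE ev where ex: "is_exponential C A \<Omega> E R pE qE ev"
    using exponential_exists[OF A \<Omega>_Obj] .
  note exs [simp] = exponential_simps[OF ex]
  note [simp] = binprod_simps[OF exs(1)]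
  obtain g h where g [simp]: "g \<in> Arr C" "Dom C g = G" "Cod C g = E" "h \<in> Arr C" "Dom C h = P"
    "Cod C h = R" and gh: "pE \<cdot> h = g \<cdot> p" "qE \<cdot> h = q" "ev \<cdot> h = \<chi>"
    using transpose_exists[OF ex bp, of \<chi>] by auto
  obtain g' h' where g' [simp]: "g' \<in> Arr C" "Dom C g' = G" "Cod C g' = E" "h' \<in> Arr C"
    "Dom C h' = P" "Cod C h' = R"
    and gh': "pE \<cdot> h' = g' \<cdot> p" "qE \<cdot> h' = q" "ev \<cdot> h' = true_at P"
    using transpose_exists[OF ex bp, of "true_at P"] by auto
  obtain \<kappa> where k: "classifies \<kappa> G (\<lambda>x. g \<cdot> x = g' \<cdot> x)"
    using classify_eq[of g G E g'] by auto
  have "g \<cdot> x = g' \<cdot> x \<longleftrightarrow> (\<forall>t \<in> Arr C. Cod C t = Dom C x \<longrightarrow>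
      (\<forall>y \<in> Arr C. Dom C y = Dom C t \<longrightarrow> Cod C y = P \<longrightarrow> p \<cdot> y = x \<cdot> t \<longrightarrow> S y))"
    if x [simp]: "x \<in> Arr C" "Cod C x = G" for x
  proof -
    obtain Q p' q' where bq: "is_binprod C (Dom C x) A Q p' q'"
      using binprod_exists[OF _ A, of "Dom C x"] by auto
    note [simp] = binprod_simps[OF bq]
    \<comment> \<open>\<open>z\<close> is \<open>x \<times> id\<close>, the generic element of the
      fibre over \<open>x\<close>: both sides of the equivalence amount to \<chi> being true at
      \<open>z\<close>.\<close>
    obtain z where z [simp]: "z \<in> Arr C" "Dom C z = Q" "Cod C z = P" and
      pz: "p \<cdot> z = x \<cdot> p'" "q \<cdot> z = q'"
      using binprod_pair[OF bp, of "x \<cdot> p'" q' Q] by auto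
    have hz: "pE \<cdot> h \<cdot> z = g \<cdot> x \<cdot> p'" "qE \<cdot> h \<cdot> z = q'" "ev \<cdot> h \<cdot> z = \<chi> \<cdot> z"
      "pE \<cdot> h' \<cdot> z = g' \<cdot> x \<cdot> p'" "qE \<cdot> h' \<cdot> z = q'" "ev \<cdot> h' \<cdot> z = true_at Q"
      using comp_cong_right[OF gh(1), of z] comp_cong_right[OF gh(2), of z]
        comp_cong_right[OF gh(3), of z] comp_cong_right[OF gh'(1), of z]
        comp_cong_right[OF gh'(2), of z] comp_cong_right[OF gh'(3), of z] pz by simp_all
    have Sz: "S z \<longleftrightarrow> \<chi> \<cdot> z = true_at Q" using classifiesD[OF c, of z] by simp
    show ?thesis
    proof
      assume eq: "g \<cdot> x = g' \<cdot> x"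
      have "g \<cdot> x \<cdot> p' = g' \<cdot> x \<cdot> p'" using comp_cong_right[OF eq, of p'] by simp
      then have "h \<cdot> z = h' \<cdot> z" by - (rule binprod_eqI[OF exs(1)], simp_all add: hz)
      then have cz: "\<chi> \<cdot> z = true_at Q" using hz(3,6) by simp
      have "S y" if [simp]: "t \<in> Arr C" "Cod C t = Dom C x" "y \<in> Arr C" "Dom C y = Dom C t"
        "Cod C y = P" and py: "p \<cdot> y = x \<cdot> t" for t y
      proof -
        \<comment> \<open>An arbitrary \<open>y\<close> over \<open>x \<cdot> t\<close> is the
          generic element reindexed along \<open>l = (t, q \<cdot> y)\<close>.\<close>
        obtain l where l [simp]: "l \<in> Arr C" "Dom C l = Dom C t" "Cod C l = Q" and
          pl: "p' \<cdot> l = t" "q' \<cdot> l = q \<cdot> y"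
          using binprod_pair[OF bq, of t "q \<cdot> y" "Dom C t"] by auto
        have "z \<cdot> l = y"
          using comp_cong_right[OF pz(1), of l] comp_cong_right[OF pz(2), of l] pl py
          by - (rule binprod_eqI[OF bp], simp_all)
        moreover have "\<chi> \<cdot> z \<cdot> l = true_at (Dom C t)" using comp_cong_right[OF cz, of l] by simp
        ultimately show "S y" using classifiesD[OF c, of y] by simp
      qed
      then show "\<forall>t \<in> Arr C. Cod C t = Dom C x \<longrightarrow>
        (\<forall>y \<in> Arr C. Dom C y = Dom C t \<longrightarrow> Cod C y = P \<longrightarrow> p \<cdot> y = x \<cdot> t \<longrightarrow> S y)"
        by blast
    next
      assume all: "\<forall>t \<in> Arr C. Cod C t = Dom C x \<longrightarrow>
        (\<forall>y \<in> Arr C. Dom C y = Dom C t \<longrightarrow> Cod C y = P \<longrightarrow> p \<cdot> y = x \<cdot> t \<longrightarrow> S y)"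
      have "\<chi> \<cdot> z = true_at Q" using all[rule_format, of p' z] pz Sz by simp
      then show "g \<cdot> x = g' \<cdot> x"
        by - (rule transpose_unique[OF ex bq, of _ "h \<cdot> z" _ "h' \<cdot> z"], simp_all add: hz)
    qed
  qed
  from classifies_cong[OF k this] show ?thesis by (rule that)
qed

text \<open>This is \<open>\<forall>\<^sub>f\<close>, the right adjoint of pulling back along \<open>f\<close>.\<close>

lemma classify_all_along:
  assumes f [simp]: "f \<in> Arr C" "Dom C f = X" "Cod C f = Y" and c: "classifies \<chi> X S"
  obtains \<kappa> where "classifies \<kappa> Y (\<lambda>y. \<forall>t \<in> Arr C. Cod C t = Dom C y \<longrightarrow>
    (\<forall>x \<in> Arr C. Dom C x = Dom C t \<longrightarrow> Cod C x = X \<longrightarrow> f \<cdot> x = y \<cdot> t \<longrightarrow> S x))"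
proof -
  have XY: "Y \<in> Obj C" "X \<in> Obj C" using Cod_Obj[of f] Dom_Obj[of f] by simp_all
  obtain P p q where bp: "is_binprod C Y X P p q" using binprod_exists[OF XY] .
  note [simp] = binprod_simps[OF bp]
  \<comment> \<open>Quantification along \<open>f\<close> is expressed by the formula
    \<open>\<forall>x. f x = y \<longrightarrow> S x\<close>, which quantifies along the product
    projection from \<open>Y \<times> X\<close>.\<close>
  obtain \<chi>1 where c1: "classifies \<chi>1 P (\<lambda>z. (f \<cdot> q) \<cdot> z = p \<cdot> z)"
    using classify_eq[of "f \<cdot> q" P Y p] by auto
  have c2: "classifies (\<chi> \<cdot> q) P (\<lambda>z. S (q \<cdot> z))" by (rule classify_comp[OF c]) simp_all
  obtain \<chi>3 where c3: "classifies \<chi>3 P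
      (\<lambda>z. \<forall>t \<in> Arr C. Cod C t = Dom C z \<longrightarrow> (f \<cdot> q) \<cdot> z \<cdot> t = p \<cdot> z \<cdot> t \<longrightarrow> S (q \<cdot> z \<cdot> t))"
    by (rule classify_imp[OF c1 c2])
  obtain \<kappa> where k: "classifies \<kappa> Y (\<lambda>y. \<forall>t \<in> Arr C. Cod C t = Dom C y \<longrightarrow>
      (\<forall>z \<in> Arr C. Dom C z = Dom C t \<longrightarrow> Cod C z = P \<longrightarrow> p \<cdot> z = y \<cdot> t \<longrightarrow>
        (\<forall>s \<in> Arr C. Cod C s = Dom C z \<longrightarrow> (f \<cdot> q) \<cdot> z \<cdot> s = p \<cdot> z \<cdot> s \<longrightarrow> S (q \<cdot> z \<cdot> s))))"
    by (rule classify_all[OF bp c3])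
  have "classifies \<kappa> Y (\<lambda>y. \<forall>t \<in> Arr C. Cod C t = Dom C y \<longrightarrow>
    (\<forall>x \<in> Arr C. Dom C x = Dom C t \<longrightarrow> Cod C x = X \<longrightarrow> f \<cdot> x = y \<cdot> t \<longrightarrow> S x))"
  proof (rule classifies_cong[OF k], intro iffI ballI impI)
    fix y t x
    assume y [simp]: "y \<in> Arr C" "Cod C y = Y" and
      all: "\<forall>t \<in> Arr C. Cod C t = Dom C y \<longrightarrow>
      (\<forall>z \<in> Arr C. Dom C z = Dom C t \<longrightarrow> Cod C z = P \<longrightarrow> p \<cdot> z = y \<cdot> t \<longrightarrow>
        (\<forall>s \<in> Arr C. Cod C s = Dom C z \<longrightarrow> (f \<cdot> q) \<cdot> z \<cdot> s = p \<cdot> z \<cdot> s \<longrightarrow> S (q \<cdot> z \<cdot> s)))"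
      and t [simp]: "t \<in> Arr C" "Cod C t = Dom C y"
      and x [simp]: "x \<in> Arr C" "Dom C x = Dom C t" "Cod C x = X" and eq: "f \<cdot> x = y \<cdot> t"
    obtain z where z [simp]: "z \<in> Arr C" "Dom C z = Dom C t" "Cod C z = P" and
      pz: "p \<cdot> z = y \<cdot> t" "q \<cdot> z = x"
      using binprod_pair[OF bp, of "y \<cdot> t" x "Dom C t"] by auto
    show "S x"
      using all[rule_format, OF t z pz(1), of "Ide C (Dom C t)"] eq pz by simp
  next
    fix y t z s
    assume y [simp]: "y \<in> Arr C" "Cod C y = Y" and
      all: "\<forall>t \<in> Arr C. Cod C t = Dom C y \<longrightarrow>
      (\<forall>x \<in> Arr C. Dom C x = Dom C t \<longrightarrow> Cod C x = X \<longrightarrow> f \<cdot> x = y \<cdot> t \<longrightarrow> S x)"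
      and t [simp]: "t \<in> Arr C" "Cod C t = Dom C y"
      and z [simp]: "z \<in> Arr C" "Dom C z = Dom C t" "Cod C z = P" and eq: "p \<cdot> z = y \<cdot> t"
      and s [simp]: "s \<in> Arr C" "Cod C s = Dom C z" and fq: "(f \<cdot> q) \<cdot> z \<cdot> s = p \<cdot> z \<cdot> s"
    show "S (q \<cdot> z \<cdot> s)"
      using all[rule_format, of "t \<cdot> s" "q \<cdot> z \<cdot> s"] fq comp_cong_right[OF eq, of s] by simp
  qed
  then show ?thesis by (rule that)
qed

subsection \<open>Degenerate objects\<close>

text \<open>Avoids presupposing an initial object, whose existence is not part of the definition of a
  topos: internally, \<open>T\<close> forces \<open>\<forall>p. p\<close>.\<close>

definition degenerate :: "'o \<Rightarrow> bool" where
  "degenerate T \<longleftrightarrow> (\<forall>t \<in> Arr C. Cod C t = T \<longrightarrow>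
     (\<forall>w \<in> Arr C. Dom C w = Dom C t \<longrightarrow> Cod C w = \<Omega> \<longrightarrow> w = true_at (Dom C t)))"

lemma degenerate_Dom:
  assumes "degenerate T" "t \<in> Arr C" "Cod C t = T"
  shows "degenerate (Dom C t)"
  unfolding degenerate_def
proof (intro ballI impI)
  fix s w
  assume "s \<in> Arr C" "Cod C s = Dom C t" "w \<in> Arr C" "Dom C w = Dom C s" "Cod C w = \<Omega>"
  then show "w = true_at (Dom C s)"
    using assms(1)[unfolded degenerate_def, rule_format, of "t \<cdot> s" w] assms(2,3) by simp
qed

text \<open>Ex falso: at a degenerate stage every truth value equals truth.\<close>

lemma degenerate_holds:
  assumes "degenerate (Dom C x)" "classifies \<chi> G S" "x \<in> Arr C" "Cod C x = G"
  shows "S x"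
proof -
  have "\<chi> \<cdot> x = true_at (Dom C x)"
    using assms(1)[unfolded degenerate_def, rule_format, of "Ide C (Dom C x)" "\<chi> \<cdot> x"]
      assms(3,4) classifies_simps[OF assms(2)] by simp
  then show ?thesis using classifiesD[OF assms(2-4)] by simp
qed

lemma degenerate_factors:
  assumes "degenerate (Dom C x)" "monic C m" "x \<in> Arr C" "Cod C x = Cod C m"
  shows "factors_through C x m"
proof -
  obtain \<chi> where "classifies \<chi> (Cod C m) (\<lambda>x. factors_through C x m)"
    using classify_monic[OF assms(2)] .
  then show ?thesis using degenerate_holds[OF assms(1)] assms(3,4) by blast
qed

lemma degenerate_eq:
  assumes "degenerate T" "f \<in> Arr C" "Dom C f = T" "g \<in> Arr C" "Dom C g = T" "Cod C f = Cod C g"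
  shows "f = g"
proof -
  have T: "T \<in> Obj C" using assms by auto
  obtain \<chi> where "classifies \<chi> T (\<lambda>x. f \<cdot> x = g \<cdot> x)"
    using classify_eq[of f T "Cod C g" g] assms by auto
  then have "f \<cdot> Ide C T = g \<cdot> Ide C T"
    using degenerate_holds[of "Ide C T" \<chi> T "\<lambda>x. f \<cdot> x = g \<cdot> x"] assms(1) T by simp
  then show ?thesis using assms by simp
qed

text \<open>Falsity is the second-order formula \<open>\<forall>w. w\<close> with \<open>w\<close>
  ranging over \<Omega>, weakened to the context \<open>G\<close>.\<close>

lemma classify_degenerate:
  assumes G: "G \<in> Obj C"
  obtains \<kappa> where "classifies \<kappa> G (\<lambda>x. degenerate (Dom C x))"
proof -
  obtain P p q where bp: "is_binprod C G \<Omega> P p q" using binprod_exists[OF G \<Omega>_Obj] .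
  note [simp] = binprod_simps[OF bp]
  have c: "classifies q P (\<lambda>y. q \<cdot> y = true_at (Dom C y))" using classifies_self[of q] by simp
  obtain \<kappa> where k: "classifies \<kappa> G (\<lambda>x. \<forall>t \<in> Arr C. Cod C t = Dom C x \<longrightarrow>
      (\<forall>y \<in> Arr C. Dom C y = Dom C t \<longrightarrow> Cod C y = P \<longrightarrow> p \<cdot> y = x \<cdot> t \<longrightarrow>
        q \<cdot> y = true_at (Dom C y)))"
    by (rule classify_all[OF bp c])
  have "classifies \<kappa> G (\<lambda>x. degenerate (Dom C x))"
  proof (rule classifies_cong[OF k], unfold degenerate_def, intro iffI ballI impI)
    fix x t w
    assume x [simp]: "x \<in> Arr C" "Cod C x = G"
      and all: "\<forall>t \<in> Arr C. Cod C t = Dom C x \<longrightarrow>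
        (\<forall>y \<in> Arr C. Dom C y = Dom C t \<longrightarrow> Cod C y = P \<longrightarrow> p \<cdot> y = x \<cdot> t \<longrightarrow>
          q \<cdot> y = true_at (Dom C y))"
      and t [simp]: "t \<in> Arr C" "Cod C t = Dom C x"
      and w [simp]: "w \<in> Arr C" "Dom C w = Dom C t" "Cod C w = \<Omega>"
    obtain y where y: "y \<in> Arr C" "Dom C y = Dom C t" "Cod C y = P" "p \<cdot> y = x \<cdot> t" "q \<cdot> y = w"
      using binprod_pair[OF bp, of "x \<cdot> t" w "Dom C t"] by auto
    show "w = true_at (Dom C t)" using all[rule_format, OF t y(1-4)] y by simp
  next
    fix x t y
    assume all: "\<forall>t \<in> Arr C. Cod C t = Dom C x \<longrightarrow>
        (\<forall>w \<in> Arr C. Dom C w = Dom C t \<longrightarrow> Cod C w = \<Omega> \<longrightarrow> w = true_at (Dom C t))"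
      and t: "t \<in> Arr C" "Cod C t = Dom C x" and y: "y \<in> Arr C" "Dom C y = Dom C t" "Cod C y = P"
    show "q \<cdot> y = true_at (Dom C y)"
      using all[rule_format, OF t, of "q \<cdot> y"] y by simp
  qed
  then show ?thesis by (rule that)
qed

text \<open>Falsity cuts out a subobject of \<open>one\<close>. An initial object has an arrow into
  it, and every stage with such an arrow forces falsity.\<close>

lemma initial_degenerate:
  assumes "initial C X"
  shows "degenerate X"
proof -
  obtain \<kappa> where k: "classifies \<kappa> one (\<lambda>x. degenerate (Dom C x))"
    using classify_degenerate[OF one_Obj] .
  obtain m where m: "monic C m" "Cod C m = one"
    "\<And>x. x \<in> Arr C \<Longrightarrow> Cod C x = one \<Longrightarrow> factors_through C x m \<longleftrightarrow> degenerate (Dom C x)"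
    using comprehension[OF k] by metis
  have "Dom C m \<in> Obj C" using m by simp
  then obtain h where h: "h \<in> Arr C" "Dom C h = X" "Cod C h = Dom C m"
    using assms unfolding initial_def by auto
  have "factors_through C (m \<cdot> h) m" using h m(1) by - (rule factors_throughI[of h], simp_all)
  then show ?thesis using m(3)[of "m \<cdot> h"] h m(1,2) by simp
qed

text \<open>A topos is balanced: the classifying arrow of \<open>m\<close> agrees with truth after
  composing with \<open>m\<close>, and an epic \<open>m\<close> cancels.\<close>

lemma monic_epic_split:
  assumes "monic C m" "epic C m"
  shows "factors_through C (Ide C (Cod C m)) m"
proof -
  have m [simp]: "m \<in> Arr C" using assms by simp
  obtain \<chi> where c: "classifies \<chi> (Cod C m) (\<lambda>x. factors_through C x m)"
    using classify_monic[OF assms(1)] .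
  note [simp] = classifies_simps[OF c]
  have "\<chi> \<cdot> m = true_at (Cod C m) \<cdot> m"
    using classifiesD[OF c, of m] factors_through_refl[of m] by simp
  then have "\<chi> = true_at (Cod C m)" by - (rule epicD[OF assms(2)], simp_all)
  then show ?thesis using classifiesD[OF c, of "Ide C (Cod C m)"] by simp
qed

subsection \<open>Images\<close>

text \<open>The image of \<open>f\<close> is \<open>{y. \<forall>p. (\<forall>x. f x = y \<longrightarrow> p) \<longrightarrow> p}\<close>. The quantification over \<open>x\<close> is
  performed along \<open>F = f \<times> id : X \<times> \<Omega> \<rightarrow> Y \<times> \<Omega>\<close>.\<close>

lemma image_exists:
  assumes f [simp]: "f \<in> Arr C"
  obtains m where "is_image C f m"
proof -
  define X Y where "X = Dom C f" and "Y = Cod C f"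
  then have [simp]: "Dom C f = X" "Cod C f = Y" by simp_all
  have XY: "Y \<in> Obj C" "X \<in> Obj C" using Cod_Obj[of f] Dom_Obj[of f] by simp_all
  obtain P p q where bp: "is_binprod C Y \<Omega> P p q" using binprod_exists[OF XY(1) \<Omega>_Obj] .
  obtain Q p' q' where bq: "is_binprod C X \<Omega> Q p' q'" using binprod_exists[OF XY(2) \<Omega>_Obj] .
  note [simp] = binprod_simps[OF bp] binprod_simps[OF bq] XY
  obtain F where F [simp]: "F \<in> Arr C" "Dom C F = Q" "Cod C F = P" and
    pF: "p \<cdot> F = f \<cdot> p'" "q \<cdot> F = q'"
    using binprod_pair[OF bp, of "f \<cdot> p'" q' Q] by auto
  have c1: "classifies q' Q (\<lambda>z. q' \<cdot> z = true_at (Dom C z))"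
    and c2: "classifies q P (\<lambda>w. q \<cdot> w = true_at (Dom C w))"
    using classifies_self[of q'] classifies_self[of q] by simp_all
  \<comment> \<open>With \<open>w = (y, p)\<close>, \<open>U w\<close> reads
    \<open>\<forall>x. f x = y \<longrightarrow> p\<close>, \<open>V w\<close> reads
    \<open>U w \<longrightarrow> p\<close>, and \<open>S y\<close> quantifies \<open>V\<close> over
    all \<open>p\<close>.\<close>
  define U where "U w \<longleftrightarrow> (\<forall>t \<in> Arr C. Cod C t = Dom C w \<longrightarrow>
    (\<forall>z \<in> Arr C. Dom C z = Dom C t \<longrightarrow> Cod C z = Q \<longrightarrow> F \<cdot> z = w \<cdot> t \<longrightarrow>
      q' \<cdot> z = true_at (Dom C z)))" for w
  obtain \<chi>3 where c3: "classifies \<chi>3 P U"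
    unfolding U_def by (rule classify_all_along[OF F c1])
  define V where "V w \<longleftrightarrow> (\<forall>s \<in> Arr C. Cod C s = Dom C w \<longrightarrow> U (w \<cdot> s) \<longrightarrow>
    q \<cdot> w \<cdot> s = true_at (Dom C (w \<cdot> s)))" for w
  obtain \<chi>4 where c4: "classifies \<chi>4 P V"
    unfolding V_def by (rule classify_imp[OF c3 c2])
  define S where "S y \<longleftrightarrow> (\<forall>t \<in> Arr C. Cod C t = Dom C y \<longrightarrow>
    (\<forall>w \<in> Arr C. Dom C w = Dom C t \<longrightarrow> Cod C w = P \<longrightarrow> p \<cdot> w = y \<cdot> t \<longrightarrow> V w))" for y
  obtain \<kappa> where k: "classifies \<kappa> Y S"
    unfolding S_def by (rule classify_all[OF bp c4])
  obtain m where m: "monic C m" "Cod C m = Y"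
    and mS: "\<And>x. x \<in> Arr C \<Longrightarrow> Cod C x = Y \<Longrightarrow> factors_through C x m \<longleftrightarrow> S x"
    using comprehension[OF k] by metis
  note [simp] = monic_Arr[OF m(1)] m(2)
  have "S f"
    unfolding S_def V_def
  proof (intro ballI impI)
    fix t w s
    assume t [simp]: "t \<in> Arr C" "Cod C t = Dom C f"
      and w [simp]: "w \<in> Arr C" "Dom C w = Dom C t" "Cod C w = P" and pw: "p \<cdot> w = f \<cdot> t"
      and s [simp]: "s \<in> Arr C" "Cod C s = Dom C w" and U: "U (w \<cdot> s)"
    have [simp]: "Cod C t = X" by simp
    \<comment> \<open>\<open>U\<close> is applied to the preimage \<open>t \<cdot> s\<close> itself,
      paired with the truth value \<open>p\<close> under consideration.\<close>
    obtain z where z [simp]: "z \<in> Arr C" "Dom C z = Dom C s" "Cod C z = Q" and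
      pz: "p' \<cdot> z = t \<cdot> s" "q' \<cdot> z = q \<cdot> w \<cdot> s"
      using binprod_pair[OF bq, of "t \<cdot> s" "q \<cdot> w \<cdot> s" "Dom C s"] by auto
    have "F \<cdot> z = w \<cdot> s"
      using comp_cong_right[OF pF(1), of z] comp_cong_right[OF pF(2), of z]
        comp_cong_right[OF pw, of s] pz
      by - (rule binprod_eqI[OF bp], simp_all)
    then show "q \<cdot> w \<cdot> s = true_at (Dom C (w \<cdot> s))"
      using U[unfolded U_def, rule_format, of "Ide C (Dom C s)" z] pz by simp
  qed
  then have fm: "factors_through C f m" using mS by simp
  have least: "factors_through C m n"
    if n: "monic C n" "Cod C n = Y" "factors_through C f n" for n
  proof -
    note [simp] = monic_Arr[OF n(1)] n(2)
    obtain \<chi> where c: "classifies \<chi> Y (\<lambda>x. factors_through C x n)"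
      using classify_monic[OF n(1)] by auto
    note [simp] = classifies_simps[OF c]
    \<comment> \<open>For leastness, the bound \<open>p\<close> is instantiated with membership in
      the competitor \<open>n\<close>; then \<open>U w\<close> says that \<open>f\<close> lands in
      \<open>n\<close>.\<close>
    obtain w where w [simp]: "w \<in> Arr C" "Dom C w = Dom C m" "Cod C w = P" and
      pw: "p \<cdot> w = m" "q \<cdot> w = \<chi> \<cdot> m"
      using binprod_pair[OF bp, of m "\<chi> \<cdot> m" "Dom C m"] by auto
    have "U w"
      unfolding U_def
    proof (intro ballI impI)
      fix t z
      assume t [simp]: "t \<in> Arr C" "Cod C t = Dom C w"
        and z [simp]: "z \<in> Arr C" "Dom C z = Dom C t" "Cod C z = Q" and Fz: "F \<cdot> z = w \<cdot> t"
      have "f \<cdot> (p' \<cdot> z) = m \<cdot> t" "q' \<cdot> z = \<chi> \<cdot> m \<cdot> t"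
        using comp_cong_right[OF pF(1), of z] comp_cong_right[OF pF(2), of z] Fz
          comp_cong_right[OF pw(1), of t] comp_cong_right[OF pw(2), of t] by simp_all
      moreover have "factors_through C (f \<cdot> (p' \<cdot> z)) n"
        using n(3) by (rule factors_through_comp) simp_all
      ultimately show "q' \<cdot> z = true_at (Dom C z)"
        using classifiesD[OF c, of "m \<cdot> t"] by simp
    qed
    moreover have "S m" using mS factors_through_refl[of m] by simp
    then have "V w"
      using S_def[THEN iffD1, rule_format, of m "Ide C (Dom C m)" w] pw by simp
    ultimately have "\<chi> \<cdot> m = true_at (Dom C m)"
      using V_def[THEN iffD1, rule_format, of w "Ide C (Dom C m)"] pw by simp
    then show ?thesis using classifiesD[OF c, of m] by simp
  qed
  then show ?thesis using that[of m] m fm unfolding is_image_def is_formula_def by simp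
qed

text \<open>If two arrows agree on \<open>e\<close>, then \<open>f\<close> factors through their
  equalizer composed with \<open>m\<close>. Leastness of \<open>m\<close> makes that equalizer
  everything.\<close>

lemma image_cover_epic:
  assumes im: "is_image C f m" and f [simp]: "f \<in> Arr C"
  obtains e where "epic C e" "Dom C e = Dom C f" "Cod C e = Dom C m" "m \<cdot> e = f"
proof -
  have m: "monic C m" "Cod C m = Cod C f" "factors_through C f m"
    and least: "\<And>n. monic C n \<Longrightarrow> Cod C n = Cod C f \<Longrightarrow> factors_through C f n \<Longrightarrow> factors_through C m n"
    using im unfolding is_image_def is_formula_def by auto
  note [simp] = monic_Arr[OF m(1)] m(2)
  obtain e where e [simp]: "e \<in> Arr C" "Dom C e = Dom C f" "Cod C e = Dom C m" and me: "m \<cdot> e = f"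
    by (rule factors_throughE[OF m(3)])
  have "epic C e"
  proof (rule epicI)
    fix u v
    assume u [simp]: "u \<in> Arr C" "Dom C u = Cod C e" and v [simp]: "v \<in> Arr C" "Dom C v = Cod C e"
      and uv: "Cod C u = Cod C v" "u \<cdot> e = v \<cdot> e"
    obtain n where n: "monic C n" "Cod C n = Dom C m"
      "\<And>x. x \<in> Arr C \<Longrightarrow> Cod C x = Dom C m \<Longrightarrow> factors_through C x n \<longleftrightarrow> u \<cdot> x = v \<cdot> x"
      using equalizer_exists[of u "Dom C m" "Cod C v" v] uv(1) by auto
    note [simp] = monic_Arr[OF n(1)] n(2)
    have "factors_through C e n" using n(3)[of e] uv(2) by simp
    then obtain h where h: "h \<in> Arr C" "Dom C h = Dom C e" "Cod C h = Dom C n" and nh: "n \<cdot> h = e"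
      by (rule factors_throughE)
    note [simp] = h[simplified]
    have "factors_through C f (m \<cdot> n)"
      using nh me by - (rule factors_throughI[of h], simp_all)
    then have "factors_through C m (m \<cdot> n)" using monic_comp[OF n(1) m(1)] least by simp
    then obtain l where l: "l \<in> Arr C" "Dom C l = Dom C m" "Cod C l = Dom C (m \<cdot> n)"
      and ml: "(m \<cdot> n) \<cdot> l = m"
      by (rule factors_throughE)
    note [simp] = l[simplified]
    have "n \<cdot> l = Ide C (Dom C m)" using ml by - (rule monicD[OF m(1)], simp_all)
    then have "factors_through C (Ide C (Dom C m)) n" by - (rule factors_throughI[of l], simp_all)
    then show "u = v" using n(3)[of "Ide C (Dom C m)"] by simp
  qed simp
  then show ?thesis using that me by simp
qed

subsection \<open>Choice implies that dense monomorphisms split\<close>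

lemma classify_neg:
  assumes c: "classifies \<chi> G S"
  obtains \<kappa> where
    "classifies \<kappa> G (\<lambda>x. \<forall>t \<in> Arr C. Cod C t = Dom C x \<longrightarrow> S (x \<cdot> t) \<longrightarrow> degenerate (Dom C t))"
proof -
  have "G \<in> Obj C" using classifies_simps[OF c] by simp
  then obtain \<delta> where d: "classifies \<delta> G (\<lambda>x. degenerate (Dom C x))"
    using classify_degenerate by metis
  obtain \<kappa> where k: "classifies \<kappa> G
      (\<lambda>x. \<forall>t \<in> Arr C. Cod C t = Dom C x \<longrightarrow> S (x \<cdot> t) \<longrightarrow> degenerate (Dom C (x \<cdot> t)))"
    by (rule classify_imp[OF c d])
  have "classifies \<kappa> G
      (\<lambda>x. \<forall>t \<in> Arr C. Cod C t = Dom C x \<longrightarrow> S (x \<cdot> t) \<longrightarrow> degenerate (Dom C t))"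
    by (rule classifies_cong[OF k]) simp
  then show ?thesis by (rule that)
qed

text \<open>This is \<not>\<not>-density, written as: an element \<open>x\<close> of the codomain
  that forces \<open>x \<notin> m\<close> lives at a degenerate stage.\<close>

definition dense :: "'m \<Rightarrow> bool" where
  "dense m \<longleftrightarrow> (\<forall>x \<in> Arr C. Cod C x = Cod C m \<longrightarrow>
     (\<forall>t \<in> Arr C. Cod C t = Dom C x \<longrightarrow> factors_through C (x \<cdot> t) m \<longrightarrow> degenerate (Dom C t)) \<longrightarrow>
     degenerate (Dom C x))"

text \<open>Diaconescu's argument, without coproducts. Put \<open>c d w = (\<not> w \<longrightarrow> d \<in> m)\<close>, so that
  \<open>c d \<bottom> = (d \<in> m)\<close> and \<open>c d \<top> = \<top>\<close>. Choosing representatives for the fibres of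
  \<open>(d, w) \<mapsto> (d, c d w)\<close> yields \<open>\<alpha>\<close>, \<open>\<beta>\<close> with \<open>c d (\<alpha> d) = c d \<bottom>\<close> and \<open>c d (\<beta> d) = \<top>\<close>, and
  \<open>\<alpha> d = \<beta> d\<close> whenever \<open>d \<in> m\<close>. By density \<open>\<not> \<alpha> d\<close> implies \<open>\<not> \<beta> d\<close>, which implies \<open>d \<in> m\<close>; hence
  \<open>c d (\<alpha> d)\<close> holds, and so does \<open>d \<in> m\<close>.\<close>

lemma dense_monic_split:
  assumes ac: "axiom_of_choice C" and m: "monic C m" and dense: "dense m"
  shows "factors_through C (Ide C (Cod C m)) m"
proof -
  define G where "G = Cod C m"
  have mG [simp]: "m \<in> Arr C" "Cod C m = G" using m G_def by simp_all
  have G [simp]: "G \<in> Obj C" using Cod_Obj[OF mG(1)] by simp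
  define E where "E x \<longleftrightarrow> factors_through C x m" for x
  have E_comp: "E (x \<cdot> t)" if "E x" "t \<in> Arr C" "Cod C t = Dom C x" for x t
    using that factors_through_comp unfolding E_def by simp
  obtain P p q where bp: "is_binprod C G \<Omega> P p q" using binprod_exists[OF G \<Omega>_Obj] .
  note [simp] = binprod_simps[OF bp]
  obtain \<chi> where chi: "classifies \<chi> G E"
    using classify_monic[OF m] unfolding E_def by auto
  have cq: "classifies q P (\<lambda>w. q \<cdot> w = true_at (Dom C w))" using classifies_self[of q] by simp
  \<comment> \<open>\<open>N\<close> is the negation of the second coordinate of a pair
    \<open>(d, w)\<close>; below, \<open>c\<close> is the formula
    \<open>\<not> w \<longrightarrow> d \<in> m\<close> and \<open>f\<close> maps
    \<open>(d, w)\<close> to \<open>(d, c d w)\<close>.\<close>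
  define N where "N w \<longleftrightarrow> (\<forall>t \<in> Arr C. Cod C t = Dom C w \<longrightarrow>
    q \<cdot> w \<cdot> t = true_at (Dom C (w \<cdot> t)) \<longrightarrow> degenerate (Dom C t))" for w
  obtain \<nu> where nu: "classifies \<nu> P N" unfolding N_def by (rule classify_neg[OF cq])
  have cp: "classifies (\<chi> \<cdot> p) P (\<lambda>w. E (p \<cdot> w))" by (rule classify_comp[OF chi]) simp_all
  obtain c where c: "classifies c P
      (\<lambda>w. \<forall>t \<in> Arr C. Cod C t = Dom C w \<longrightarrow> N (w \<cdot> t) \<longrightarrow> E (p \<cdot> w \<cdot> t))"
    by (rule classify_imp[OF nu cp])
  note [simp] = classifies_simps(1-3)[OF c]
  obtain f where f [simp]: "f \<in> Arr C" "Dom C f = P" "Cod C f = P" and pf: "p \<cdot> f = p" "q \<cdot> f = c"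
    using binprod_pair[OF bp, of p c P] by auto
  obtain n where im: "is_image C f n" using image_exists[OF f(1)] .
  then have n: "monic C n" "Cod C n = P" unfolding is_image_def is_formula_def by simp_all
  obtain e where e: "epic C e" and en: "Dom C e = Dom C f" "Cod C e = Dom C n" and ne: "n \<cdot> e = f"
    using image_cover_epic[OF im f(1)] .
  note [simp] = n(2) en[simplified]
  have [simp]: "e \<in> Arr C" "n \<in> Arr C" using e n(1) unfolding epic_def by simp_all
  \<comment> \<open>Choice: \<open>s \<cdot> e\<close> sends each pair to a chosen representative of
    its fibre under \<open>f\<close>.\<close>
  obtain s where s [simp]: "s \<in> Arr C" "Dom C s = Dom C n" "Cod C s = P"
    and es: "e \<cdot> s = Ide C (Dom C n)"
    using choice_section[OF ac e] by auto
  \<comment> \<open>\<delta> is constant falsity on \<open>G\<close>, so \<open>u\<close> and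
    \<open>v\<close> are the pairs of \<open>d\<close> with \<bottom> and with \<top>.\<close>
  obtain \<delta> where d: "classifies \<delta> G (\<lambda>x. degenerate (Dom C x))" using classify_degenerate[OF G] .
  note [simp] = classifies_simps(1-3)[OF d]
  obtain u where u [simp]: "u \<in> Arr C" "Dom C u = G" "Cod C u = P"
    and pu: "p \<cdot> u = Ide C G" "q \<cdot> u = \<delta>"
    using binprod_pair[OF bp, of "Ide C G" \<delta> G] by auto
  obtain v where v [simp]: "v \<in> Arr C" "Dom C v = G" "Cod C v = P"
    and pv: "p \<cdot> v = Ide C G" "q \<cdot> v = true_at G"
    using binprod_pair[OF bp, of "Ide C G" "true_at G" G] by auto
  \<comment> \<open>Here \<alpha> and \<beta> are the whole chosen pairs, with values in
    \<open>G \<times> \<Omega>\<close>; the truth values of the informal argument are their second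
    coordinates.\<close>
  define \<alpha> where "\<alpha> = s \<cdot> e \<cdot> u"
  define \<beta> where "\<beta> = s \<cdot> e \<cdot> v"
  have ab [simp]: "\<alpha> \<in> Arr C" "Dom C \<alpha> = G" "Cod C \<alpha> = P" "\<beta> \<in> Arr C" "Dom C \<beta> = G" "Cod C \<beta> = P"
    unfolding \<alpha>_def \<beta>_def by simp_all
  \<comment> \<open>A representative stays in its fibre, as \<open>f = n \<cdot> e\<close> and
    \<open>e \<cdot> s\<close> is an identity.\<close>
  have fse: "f \<cdot> s \<cdot> e \<cdot> w = f \<cdot> w" if [simp]: "w \<in> Arr C" "Dom C w = G" "Cod C w = P" for w
    using comp_cong_right[OF ne, of "s \<cdot> e \<cdot> w"] comp_cong_right[OF ne, of w]
      comp_cong_right[OF es, of "e \<cdot> w"] by simp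
  have "f \<cdot> \<alpha> = f \<cdot> u" "f \<cdot> \<beta> = f \<cdot> v" unfolding \<alpha>_def \<beta>_def by (simp_all add: fse)
  then have pc: "p \<cdot> \<alpha> = Ide C G" "c \<cdot> \<alpha> = c \<cdot> u" "p \<cdot> \<beta> = Ide C G" "c \<cdot> \<beta> = c \<cdot> v"
    using comp_cong_right[OF pf(1), of \<alpha>] comp_cong_right[OF pf(2), of \<alpha>]
      comp_cong_right[OF pf(1), of \<beta>] comp_cong_right[OF pf(2), of \<beta>]
      comp_cong_right[OF pf(1), of u] comp_cong_right[OF pf(2), of u]
      comp_cong_right[OF pf(1), of v] comp_cong_right[OF pf(2), of v] pu pv by simp_all
  have c_iff: "c \<cdot> w \<cdot> x = true_at (Dom C x) \<longleftrightarrow>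
      (\<forall>t \<in> Arr C. Cod C t = Dom C x \<longrightarrow> N (w \<cdot> x \<cdot> t) \<longrightarrow> E (x \<cdot> t))"
    if [simp]: "w \<in> Arr C" "Dom C w = G" "Cod C w = P" "x \<in> Arr C" "Cod C x = G"
      and pw: "p \<cdot> w = Ide C G" for w x
    using classifiesD[OF c, of "w \<cdot> x"] comp_cong_right[OF pw, of "x \<cdot> _"] by simp
  \<comment> \<open>The premise \<not>\<bottom> always holds, so the implication reduces to its
    conclusion.\<close>
  have cu: "c \<cdot> u \<cdot> x = true_at (Dom C x) \<longleftrightarrow> E x" if [simp]: "x \<in> Arr C" "Cod C x = G" for x
  proof -
    have "N (u \<cdot> x \<cdot> t)" if [simp]: "t \<in> Arr C" "Cod C t = Dom C x" for t
      unfolding N_def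
    proof (intro ballI impI)
      fix r
      assume "r \<in> Arr C" "Cod C r = Dom C (u \<cdot> x \<cdot> t)"
        "q \<cdot> (u \<cdot> x \<cdot> t) \<cdot> r = true_at (Dom C ((u \<cdot> x \<cdot> t) \<cdot> r))"
      then show "degenerate (Dom C r)"
        using classifiesD[OF d, of "x \<cdot> t \<cdot> r"] comp_cong_right[OF pu(2), of "x \<cdot> t \<cdot> r"] by simp
    qed
    then show ?thesis
      using c_iff[of u x] pu(1) E_comp[of x] by (auto dest!: bspec[of _ _ "Ide C (Dom C x)"])
  qed
  \<comment> \<open>The premise \<not>\<top> can hold only at degenerate stages, where everything is
    true.\<close>
  have cv: "c \<cdot> v \<cdot> x = true_at (Dom C x)" if [simp]: "x \<in> Arr C" "Cod C x = G" for x
  proof -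
    have "E (x \<cdot> t)" if [simp]: "t \<in> Arr C" "Cod C t = Dom C x" and N: "N (v \<cdot> x \<cdot> t)" for t
    proof -
      have "degenerate (Dom C t)"
        using N[unfolded N_def, rule_format, of "Ide C (Dom C t)"]
          comp_cong_right[OF pv(2), of "x \<cdot> t"] by simp
      then show ?thesis using degenerate_holds[OF _ chi, of "x \<cdot> t"] by simp
    qed
    then show ?thesis using c_iff[of v x] pv(1) by simp
  qed
  have agree: "\<alpha> \<cdot> x = \<beta> \<cdot> x" if [simp]: "x \<in> Arr C" "Cod C x = G" and "E x" for x
  proof -
    \<comment> \<open>On \<open>m\<close> both truth values are \<top>, so \<open>u\<close> and
      \<open>v\<close> lie in the same fibre and receive the same representative.\<close>
    have "c \<cdot> u \<cdot> x = c \<cdot> v \<cdot> x" using cu cv that by simp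
    then have "f \<cdot> u \<cdot> x = f \<cdot> v \<cdot> x"
      using comp_cong_right[OF pf(1), of "u \<cdot> x"] comp_cong_right[OF pf(2), of "u \<cdot> x"]
        comp_cong_right[OF pf(1), of "v \<cdot> x"] comp_cong_right[OF pf(2), of "v \<cdot> x"]
        comp_cong_right[OF pu(1), of x] comp_cong_right[OF pv(1), of x]
      by - (rule binprod_eqI[OF bp], simp_all)
    then have "e \<cdot> u \<cdot> x = e \<cdot> v \<cdot> x"
      using comp_cong_right[OF ne, of "u \<cdot> x"] comp_cong_right[OF ne, of "v \<cdot> x"]
      by - (rule monicD[OF n(1)], simp_all)
    then show ?thesis unfolding \<alpha>_def \<beta>_def by simp
  qed
  have "E t" if [simp]: "t \<in> Arr C" "Cod C t = G" and Na: "N (\<alpha> \<cdot> t)" for t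
  proof -
    have "N (\<beta> \<cdot> t)"
      unfolding N_def
    proof (intro ballI impI)
      fix r
      assume r [simp]: "r \<in> Arr C" and "Cod C r = Dom C (\<beta> \<cdot> t)"
        and qb: "q \<cdot> (\<beta> \<cdot> t) \<cdot> r = true_at (Dom C ((\<beta> \<cdot> t) \<cdot> r))"
      then have [simp]: "Cod C r = Dom C t" by simp
      have qb: "q \<cdot> \<beta> \<cdot> t \<cdot> r = true_at (Dom C r)" using qb by simp
      \<comment> \<open>Suppose \<beta> holds at \<open>r\<close>. Wherever
        \<open>t \<cdot> r\<close> enters \<open>m\<close>, \<alpha> equals \<beta> and hence holds,
        against \<open>Na\<close>. So \<open>t \<cdot> r\<close> avoids \<open>m\<close>, and
        density makes \<open>r\<close> degenerate.\<close>
      have "degenerate (Dom C l)"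
        if l [simp]: "l \<in> Arr C" "Cod C l = Dom C r" and "E (t \<cdot> r \<cdot> l)" for l
      proof -
        have "\<alpha> \<cdot> t \<cdot> r \<cdot> l = \<beta> \<cdot> t \<cdot> r \<cdot> l" using agree[of "t \<cdot> r \<cdot> l"] that by simp
        then have "q \<cdot> \<alpha> \<cdot> t \<cdot> r \<cdot> l = true_at (Dom C l)" using comp_cong_right[OF qb, of l] by simp
        then show ?thesis using Na[unfolded N_def, rule_format, of "r \<cdot> l"] by simp
      qed
      then show "degenerate (Dom C r)"
        using dense[unfolded dense_def, rule_format, of "t \<cdot> r"] unfolding E_def by simp
    qed
    \<comment> \<open>Since \<open>c\<close> is true at \<beta>, the negation of \<beta> just proved
      yields membership in \<open>m\<close>.\<close>
    moreover have "c \<cdot> \<beta> \<cdot> t = true_at (Dom C t)"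
      using comp_cong_right[OF pc(4), of t] cv[of t] by simp
    ultimately show ?thesis
      using c_iff[of \<beta> t] pc(3) by (auto dest!: bspec[of _ _ "Ide C (Dom C t)"])
  qed
  \<comment> \<open>The implication just proved is \<open>c\<close> at \<alpha>; and
    \<open>c \<cdot> \<alpha> = c \<cdot> u\<close> is membership in \<open>m\<close>.\<close>
  then have "c \<cdot> \<alpha> = true_at G" using c_iff[of \<alpha> "Ide C G"] pc(1) by simp
  then have "E (Ide C G)" using pc(2) cu[of "Ide C G"] by simp
  then show ?thesis unfolding E_def by simp
qed

section \<open>Extending arrows along monomorphisms\<close>

lemma extend_along_monic:
  assumes ac: "axiom_of_choice C" and m: "monic C m"
    and g [simp]: "g \<in> Arr C" "Dom C g = Dom C m" "Cod C g = A"
    and a [simp]: "a \<in> Arr C" "Dom C a = one" "Cod C a = A"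
  obtains f where "f \<in> Arr C" "Dom C f = Cod C m" "Cod C f = A" "f \<cdot> m = g"
proof -
  define G where "G = Cod C m"
  have mG [simp]: "m \<in> Arr C" "Cod C m = G" using m G_def by simp_all
  then have GA [simp]: "G \<in> Obj C" "A \<in> Obj C"
    using Cod_Obj[OF mG(1)] Cod_Obj[OF g(1)] by simp_all
  obtain P p q where bp: "is_binprod C G A P p q" using binprod_exists[OF GA] .
  note [simp] = binprod_simps[OF bp]
  \<comment> \<open>\<gamma> is the graph of \<open>g\<close> as a subobject of
    \<open>G \<times> A\<close>; the condition \<open>y = g x\<close> becomes membership of
    \<open>(x, y)\<close> in it.\<close>
  obtain \<gamma> where gr [simp]: "\<gamma> \<in> Arr C" "Dom C \<gamma> = Dom C m" "Cod C \<gamma> = P"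
    and pg: "p \<cdot> \<gamma> = m" "q \<cdot> \<gamma> = g"
    using binprod_pair[OF bp, of m g "Dom C m"] by auto
  have gm: "monic C \<gamma>"
  proof (rule monicI)
    fix h k
    assume a: "h \<in> Arr C" "k \<in> Arr C" "Dom C h = Dom C k" "Cod C h = Dom C \<gamma>" "Cod C k = Dom C \<gamma>"
      and eq: "\<gamma> \<cdot> h = \<gamma> \<cdot> k"
    have "m \<cdot> h = m \<cdot> k"
      using comp_cong_right[OF pg(1), of h] comp_cong_right[OF pg(1), of k] eq a by simp
    then show "h = k" using a by - (rule monicD[OF m], simp_all)
  qed simp
  obtain \<chi>1 where c1: "classifies \<chi>1 G (\<lambda>x. factors_through C x m)"
    using classify_monic[OF m] by auto
  have c1': "classifies (\<chi>1 \<cdot> p) P (\<lambda>z. factors_through C (p \<cdot> z) m)"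
    by (rule classify_comp[OF c1]) simp_all
  obtain \<chi>2 where c2: "classifies \<chi>2 P (\<lambda>z. factors_through C z \<gamma>)"
    using classify_monic[OF gm] by auto
  define S where "S z \<longleftrightarrow> (\<forall>t \<in> Arr C. Cod C t = Dom C z \<longrightarrow>
    factors_through C (p \<cdot> z \<cdot> t) m \<longrightarrow> factors_through C (z \<cdot> t) \<gamma>)" for z
  obtain \<chi>3 where c3: "classifies \<chi>3 P S"
    unfolding S_def by (rule classify_imp[OF c1' c2])
  obtain r where r: "monic C r" "Cod C r = P"
    and rS: "\<And>z. z \<in> Arr C \<Longrightarrow> Cod C z = P \<Longrightarrow> factors_through C z r \<longleftrightarrow> S z"
    using comprehension[OF c3] by metis
  note [simp] = monic_Arr[OF r(1)] r(2)
  \<comment> \<open>The projection need not be shown to cover \<open>G\<close> pointwise, which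
    would take a case distinction on \<open>x \<in> m\<close>. It suffices that the equalizer
    \<open>n\<close> of any two arrows agreeing on it is dense, since dense monomorphisms
    split.\<close>
  have "epic C (p \<cdot> r)"
  proof (rule epicI)
    fix u v
    assume u: "u \<in> Arr C" "Dom C u = Cod C (p \<cdot> r)" and v: "v \<in> Arr C" "Dom C v = Cod C (p \<cdot> r)"
      and uv: "Cod C u = Cod C v" "u \<cdot> (p \<cdot> r) = v \<cdot> (p \<cdot> r)"
    note [simp] = u[simplified] v[simplified]
    obtain n where n: "monic C n" "Cod C n = G"
      and nn: "\<And>x. x \<in> Arr C \<Longrightarrow> Cod C x = G \<Longrightarrow> factors_through C x n \<longleftrightarrow> u \<cdot> x = v \<cdot> x"
      using equalizer_exists[of u G "Cod C v" v] uv(1) by auto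
    note [simp] = monic_Arr[OF n(1)] n(2)
    have S_n: "factors_through C (p \<cdot> z) n" if [simp]: "z \<in> Arr C" "Cod C z = P" and "S z" for z
    proof -
      have "factors_through C z r" using rS that by simp
      then obtain h where h: "h \<in> Arr C" "Dom C h = Dom C z" "Cod C h = Dom C r" "r \<cdot> h = z"
        by (rule factors_throughE)
      then have "u \<cdot> (p \<cdot> z) = v \<cdot> (p \<cdot> z)" using comp_cong_right[OF uv(2), of h] by simp
      then show ?thesis using nn by simp
    qed
    \<comment> \<open>The graph satisfies \<open>S\<close>, so its projection \<open>m\<close> is
      contained in \<open>n\<close>.\<close>
    have "S \<gamma>"
      unfolding S_def using factors_throughI[of _ "\<gamma> \<cdot> _" \<gamma>] by simp
    then have mn: "factors_through C m n" using S_n[of \<gamma>] pg by simp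
    have "dense n"
      unfolding dense_def
    proof (intro ballI impI)
      fix x
      assume x: "x \<in> Arr C" "Cod C x = Cod C n"
        and avoids: "\<forall>t \<in> Arr C. Cod C t = Dom C x \<longrightarrow> factors_through C (x \<cdot> t) n \<longrightarrow> degenerate (Dom C t)"
      note [simp] = x[simplified]
      \<comment> \<open>If \<open>x\<close> avoids \<open>n\<close>, it avoids the smaller
        \<open>m\<close>, so \<open>(x, a)\<close> satisfies \<open>S\<close> vacuously. Its
        projection \<open>x\<close> then lies in \<open>n\<close> after all.\<close>
      obtain z where z [simp]: "z \<in> Arr C" "Dom C z = Dom C x" "Cod C z = P"
        and pz: "p \<cdot> z = x" "q \<cdot> z = a \<cdot> bang (Dom C x)"
        using binprod_pair[OF bp, of x "a \<cdot> bang (Dom C x)" "Dom C x"] by auto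
      have "S z"
        unfolding S_def
      proof (intro ballI impI)
        fix t
        assume t: "t \<in> Arr C" "Cod C t = Dom C z" and xm: "factors_through C (p \<cdot> z \<cdot> t) m"
        note [simp] = t[simplified]
        have "factors_through C (x \<cdot> t) m" using xm comp_cong_right[OF pz(1), of t] by simp
        then have "factors_through C (x \<cdot> t) n" by (rule factors_through_trans[OF _ mn]) simp_all
        then have "degenerate (Dom C t)" using avoids by simp
        then show "factors_through C (z \<cdot> t) \<gamma>" using degenerate_factors[OF _ gm] by simp
      qed
      then have "factors_through C x n" using S_n[of z] pz by simp
      then show "degenerate (Dom C x)" using avoids[rule_format, of "Ide C (Dom C x)"] by simp
    qed
    then have "factors_through C (Ide C G) n" using dense_monic_split[OF ac n(1)] by simp
    then show "u = v" using nn[of "Ide C G"] by simp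
  qed simp
  then obtain s where s: "s \<in> Arr C" "Dom C s = Cod C (p \<cdot> r)" "Cod C s = Dom C (p \<cdot> r)"
    and ps: "(p \<cdot> r) \<cdot> s = Ide C (Cod C (p \<cdot> r))"
    using choice_section[OF ac] by metis
  note [simp] = s[simplified]
  have prs: "p \<cdot> r \<cdot> s = Ide C G" using ps by simp
  \<comment> \<open>\<open>r \<cdot> s\<close> is a section of \<open>p\<close> with values in
    \<open>S\<close>. Restricted to \<open>m\<close>, where the premise of \<open>S\<close> holds,
    it must lie on the graph of \<open>g\<close>.\<close>
  have "S (r \<cdot> s)" using rS[of "r \<cdot> s"] factors_throughI[of s "r \<cdot> s" r] by simp
  moreover have prsm: "p \<cdot> r \<cdot> s \<cdot> m = m" using comp_cong_right[OF prs, of m] by simp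
  ultimately have "factors_through C (r \<cdot> s \<cdot> m) \<gamma>"
    using S_def[THEN iffD1, rule_format, of "r \<cdot> s" m] factors_through_refl[of m] by simp
  then obtain h where h: "h \<in> Arr C" "Dom C h = Dom C (r \<cdot> s \<cdot> m)" "Cod C h = Dom C \<gamma>"
    and gh: "\<gamma> \<cdot> h = r \<cdot> s \<cdot> m"
    by (rule factors_throughE)
  note [simp] = h[simplified]
  have "m \<cdot> h = m" using comp_cong_right[OF pg(1), of h] gh prsm by simp
  then have "h = Ide C (Dom C m)" by - (rule monicD[OF m], simp_all)
  then have "(q \<cdot> r \<cdot> s) \<cdot> m = g" using gh pg by simp
  then show ?thesis by (intro that[of "q \<cdot> r \<cdot> s"]) simp_all
qed

subsection \<open>The epsilon calculus\<close>

lemma epsilon_term_exists: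
  assumes "full_epsilon_calculus C" "set As \<subseteq> Obj C" "\<And>B. B \<in> set As \<Longrightarrow> \<not> initial C B"
    "is_list_product C As G ps" "A \<in> Obj C" "\<not> initial C A" "is_binprod C G A P \<pi> q"
    "is_formula C P \<psi>"
  obtains \<epsilon> where "\<epsilon> \<in> Arr C" "Dom C \<epsilon> = G" "Cod C \<epsilon> = A"
    "\<And>\<phi> \<phi>'. interprets_exists C \<pi> \<psi> \<phi> \<Longrightarrow> interprets_subst C \<pi> q \<psi> \<epsilon> \<phi>' \<Longrightarrow> derivable C G \<phi> \<phi>'"
proof -
  have "\<exists>\<epsilon> \<in> hom C G A. \<forall>\<phi> \<phi>'.
      interprets_exists C \<pi> \<psi> \<phi> \<and> interprets_subst C \<pi> q \<psi> \<epsilon> \<phi>' \<longrightarrow> derivable C G \<phi> \<phi>'"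
    using assms unfolding full_epsilon_calculus_def by blast
  then show ?thesis using that by auto
qed

text \<open>A monomorphism through which an epimorphism factors is itself epic, hence split by
  balancedness.\<close>

lemma is_image_epic:
  assumes "epic C e"
  shows "is_image C e (Ide C (Cod C e))"
proof -
  have e [simp]: "e \<in> Arr C" using assms unfolding epic_def by simp
  have "factors_through C (Ide C (Cod C e)) n"
    if n: "monic C n" "Cod C n = Cod C e" "factors_through C e n" for n
  proof -
    note [simp] = monic_Arr[OF n(1)] n(2)
    obtain h where h: "h \<in> Arr C" "Dom C h = Dom C e" "Cod C h = Dom C n" "n \<cdot> h = e"
      by (rule factors_throughE[OF n(3)])
    have "epic C n"
    proof (rule epicI)
      fix u v
      assume uv: "u \<in> Arr C" "v \<in> Arr C" "Dom C u = Cod C n" "Dom C v = Cod C n" "Cod C u = Cod C v"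
        and eq: "u \<cdot> n = v \<cdot> n"
      have "u \<cdot> n \<cdot> h = v \<cdot> n \<cdot> h" using comp_cong_right[OF eq, of h] uv h(1-3) by simp
      then show "u = v" using uv unfolding h(4) by - (rule epicD[OF assms], simp_all)
    qed simp
    then show ?thesis using monic_epic_split[OF n(1)] by simp
  qed
  moreover have "monic C (Ide C (Cod C e))" by (rule monicI) simp_all
  moreover have "factors_through C e (Ide C (Cod C e))" by (rule factors_throughI[of e]) simp_all
  ultimately show ?thesis unfolding is_image_def is_formula_def by simp
qed

section \<open>From the full \<epsilon>-calculus to choice and points\<close>

lemma full_epsilon_calculus_choice:
  assumes eps: "full_epsilon_calculus C"
  shows "axiom_of_choice C"
  unfolding axiom_of_choice_def
proof (intro allI impI)
  fix e
  assume epi: "epic C e"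
  define X Y where "X = Dom C e" and "Y = Cod C e"
  have e [simp]: "e \<in> Arr C" "Dom C e = X" "Cod C e = Y"
    using epi unfolding epic_def X_def Y_def by simp_all
  have XY [simp]: "X \<in> Obj C" "Y \<in> Obj C" using Dom_Obj[OF e(1)] Cod_Obj[OF e(1)] by simp_all
  consider "initial C X" | "initial C Y" | "\<not> initial C X" "\<not> initial C Y" by blast
  then have "\<exists>s. s \<in> Arr C \<and> Dom C s = Y \<and> Cod C s = X \<and> e \<cdot> s = Ide C Y"
  proof cases
    case 1
    \<comment> \<open>Any stage with an arrow to an initial object is degenerate, so parallel arrows
      into \<open>X\<close> coincide. Balancedness then splits \<open>e\<close>.\<close>
    have "monic C e"
    proof (rule monicI)
      fix f g
      assume f: "f \<in> Arr C" and g: "g \<in> Arr C" and fg: "Dom C f = Dom C g" "Cod C f = Dom C e"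
        "Cod C g = Dom C e"
      have "degenerate (Dom C g)" by (rule degenerate_Dom[OF initial_degenerate[OF 1] g]) (simp add: fg)
      then show "f = g" by (rule degenerate_eq) (simp_all add: f g fg)
    qed simp
    then have "factors_through C (Ide C Y) e" using monic_epic_split[OF _ epi] by simp
    then show ?thesis by (rule factors_throughE) auto
  next
    case 2
    then have "\<exists>!s. s \<in> hom C Y X" unfolding initial_def using XY(1) by blast
    then obtain s where s: "s \<in> Arr C" "Dom C s = Y" "Cod C s = X" by auto
    have "\<exists>!f. f \<in> hom C Y Y" using 2 unfolding initial_def by simp
    moreover have "e \<cdot> s \<in> hom C Y Y" "Ide C Y \<in> hom C Y Y" using s by simp_all
    ultimately have "e \<cdot> s = Ide C Y" by blast
    with s show ?thesis by blast
  next
    case 3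
    have prod: "is_list_product C [Y] Y [Ide C Y]"
      unfolding is_list_product_def by (auto simp: list_all2_Cons2)
    obtain P \<pi> q where bp: "is_binprod C Y X P \<pi> q" using binprod_exists[OF XY(2,1)] .
    note [simp] = binprod_simps[OF bp]
    \<comment> \<open>\<gamma> is the formula \<open>e x = y\<close> in context \<open>y, x\<close>.
      Its existential closure over \<open>x\<close> is true, as \<open>e\<close> is epic.\<close>
    obtain \<gamma> where g [simp]: "\<gamma> \<in> Arr C" "Dom C \<gamma> = X" "Cod C \<gamma> = P"
      and pg: "\<pi> \<cdot> \<gamma> = e" "q \<cdot> \<gamma> = Ide C X"
      using binprod_pair[OF bp, of e "Ide C X" X] by auto
    have gm: "monic C \<gamma>" using pg by (intro split_monic[of q]) simp_all
    obtain \<epsilon> where ep [simp]: "\<epsilon> \<in> Arr C" "Dom C \<epsilon> = Y" "Cod C \<epsilon> = X"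
      and der: "\<And>\<phi> \<phi>'. interprets_exists C \<pi> \<gamma> \<phi> \<Longrightarrow> interprets_subst C \<pi> q \<gamma> \<epsilon> \<phi>' \<Longrightarrow> derivable C Y \<phi> \<phi>'"
      using epsilon_term_exists[OF eps _ _ prod XY(1) 3(1) bp, of \<gamma>] gm 3(2)
      by (auto simp: is_formula_def)
    obtain s where s [simp]: "s \<in> Arr C" "Dom C s = Y" "Cod C s = P"
      and ps: "\<pi> \<cdot> s = Ide C Y" "q \<cdot> s = \<epsilon>"
      using binprod_pair[OF bp, of "Ide C Y" \<epsilon> Y] by auto
    obtain \<phi> k where pb: "is_pullback C \<phi> k s \<gamma>" using pullback_exists[of s \<gamma>] by auto
    note pbs = pullback_simps[OF pb]
    note [simp] = pbs(1-8)[simplified]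
    have "interprets_exists C \<pi> \<gamma> (Ide C Y)"
      using is_image_epic[OF epi] pg unfolding interprets_exists_def by simp
    moreover have "interprets_subst C \<pi> q \<gamma> \<epsilon> \<phi>"
      unfolding interprets_subst_def using pb ps by (intro bexI[of _ s] exI[of _ k]) simp_all
    ultimately have "factors_through C (Ide C Y) \<phi>" using der unfolding derivable_def by blast
    then obtain h where h: "h \<in> Arr C" "Dom C h = Dom C (Ide C Y)" "Cod C h = Dom C \<phi>"
      and ph: "\<phi> \<cdot> h = Ide C Y"
      by (rule factors_throughE)
    note [simp] = h[simplified]
    \<comment> \<open>Substitution of \<epsilon> holds everywhere, so
      \<open>s = (id, \<epsilon>)\<close> factors through the graph as
      \<open>\<gamma> \<cdot> k \<cdot> h\<close>; comparing first coordinates shows that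
      \<open>k \<cdot> h\<close> is a section.\<close>
    have "e \<cdot> k \<cdot> h = \<pi> \<cdot> \<gamma> \<cdot> k \<cdot> h" using comp_cong_right[OF pg(1), of "k \<cdot> h"] by simp
    also have "\<gamma> \<cdot> k \<cdot> h = s" using comp_cong_right[OF pbs(9)[symmetric], of h] ph by simp
    finally have "e \<cdot> (k \<cdot> h) = Ide C Y" using ps by simp
    then show ?thesis by (intro exI[of _ "k \<cdot> h"]) simp
  qed
  then show "\<exists>s \<in> hom C (Cod C e) (Dom C e). e \<cdot> s = Ide C (Cod C e)" by auto
qed

lemma full_epsilon_calculus_epic_terminal:
  assumes eps: "full_epsilon_calculus C" and A: "A \<in> Obj C" "\<not> initial C A"
    and T: "terminal C T" and f: "f \<in> Arr C" "Dom C f = A" "Cod C f = T"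
  shows "epic C f"
proof -
  have TO: "T \<in> Obj C" using T unfolding terminal_def by simp
  \<comment> \<open>Any terminal object interprets the empty context, so the \<epsilon>-term of the
    true formula is an arrow \<open>T \<rightarrow> A\<close>.\<close>
  have prod: "is_list_product C [] T []"
    unfolding is_list_product_def using T unfolding terminal_def by simp
  obtain P \<pi> q where bp: "is_binprod C T A P \<pi> q" using binprod_exists[OF TO A(1)] .
  have "P \<in> Obj C" using Dom_Obj[of \<pi>] binprod_simps[OF bp] by simp
  then have form: "is_formula C P (Ide C P)" unfolding is_formula_def by (auto intro: monicI)
  obtain a where a: "a \<in> Arr C" "Dom C a = T" "Cod C a = A"
    using epsilon_term_exists[OF eps _ _ prod A bp form] by auto
  have "\<exists>!h. h \<in> hom C T T" using T unfolding terminal_def by simp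
  moreover have "f \<cdot> a \<in> hom C T T" "Ide C T \<in> hom C T T" using f a TO by simp_all
  ultimately have "f \<cdot> a = Ide C T" by blast
  then show ?thesis using f a by (intro split_epic[of f a]) simp_all
qed

section \<open>From choice to \<epsilon>-terms\<close>

lemma epsilon_topos_full_epsilon_calculus:
  assumes eps: "epsilon_topos C"
  shows "full_epsilon_calculus C"
  unfolding full_epsilon_calculus_def
proof (intro allI impI, elim conjE)
  fix As G ps A P \<pi> q \<psi>
  assume A [simp]: "A \<in> Obj C" and nA: "\<not> initial C A" and bp: "is_binprod C G A P \<pi> q"
    and "is_formula C P \<psi>"
  then have psi: "monic C \<psi>" "Cod C \<psi> = P" unfolding is_formula_def by simp_all
  note [simp] = binprod_simps[OF bp] monic_Arr[OF psi(1)] psi(2)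
  have ac: "axiom_of_choice C" using eps unfolding epsilon_topos_def by simp
  have "bang A \<in> hom C A one" by simp
  then have "epic C (bang A)" using eps terminal_one nA A unfolding epsilon_topos_def by blast
  from choice_section[OF ac this]
  obtain a where a: "a \<in> Arr C" "Dom C a = one" "Cod C a = A" by auto
  obtain m where im: "is_image C (\<pi> \<cdot> \<psi>) m" using image_exists[of "\<pi> \<cdot> \<psi>"] by auto
  then have m: "monic C m" "Cod C m = G" unfolding is_image_def is_formula_def by simp_all
  note [simp] = monic_Arr[OF m(1)] m(2)
  obtain e where epi: "epic C e" and e: "Dom C e = Dom C (\<pi> \<cdot> \<psi>)" "Cod C e = Dom C m"
    and me: "m \<cdot> e = \<pi> \<cdot> \<psi>"
    using image_cover_epic[OF im] by auto
  have [simp]: "e \<in> Arr C" using epi unfolding epic_def by simp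
  note [simp] = e[simplified]
  obtain s where s [simp]: "s \<in> Arr C" "Dom C s = Dom C m" "Cod C s = Dom C \<psi>"
    and es: "e \<cdot> s = Ide C (Dom C m)"
    using choice_section[OF ac epi] by auto
  \<comment> \<open>The witness \<open>q \<cdot> \<psi> \<cdot> s\<close> lives only on the image of
    \<open>\<pi> \<cdot> \<psi>\<close>; the point \<open>a\<close> of \<open>A\<close> permits its
    extension to all of \<open>G\<close>.\<close>
  obtain \<epsilon> where ep [simp]: "\<epsilon> \<in> Arr C" "Dom C \<epsilon> = G" "Cod C \<epsilon> = A" and em: "\<epsilon> \<cdot> m = q \<cdot> \<psi> \<cdot> s"
    using extend_along_monic[OF ac m(1), of "q \<cdot> \<psi> \<cdot> s" A a] a by auto
  have "\<pi> \<cdot> \<psi> \<cdot> s = m \<cdot> e \<cdot> s" using comp_cong_right[OF me, of s] by simp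
  then have ps: "\<pi> \<cdot> \<psi> \<cdot> s = m" by (simp add: es)
  have "derivable C G \<phi> \<phi>'"
    if ex: "interprets_exists C \<pi> \<psi> \<phi>" and sub: "interprets_subst C \<pi> q \<psi> \<epsilon> \<phi>'" for \<phi> \<phi>'
  proof -
    obtain r k where r [simp]: "r \<in> Arr C" "Dom C r = G" "Cod C r = P"
      and pr: "\<pi> \<cdot> r = Ide C G" "q \<cdot> r = \<epsilon>" and pb: "is_pullback C \<phi>' k r \<psi>"
      using sub unfolding interprets_subst_def by auto
    have phi': "monic C \<phi>'" "Cod C \<phi>' = G"
      using pullback_monic[OF pb psi(1)] pullback_simps(7)[OF pb] by simp_all
    have phi: "monic C \<phi>" "Cod C \<phi> = G" "factors_through C \<phi> m"
      using ex im unfolding interprets_exists_def is_image_def is_formula_def by simp_all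
    \<comment> \<open>On the image, \<open>r = (id, \<epsilon>)\<close> is the chosen element of
      \<psi>, so \<open>m\<close> lifts to the pullback \<phi>'. The given image \<phi> lies below
      \<open>m\<close> by leastness.\<close>
    have "r \<cdot> m = \<psi> \<cdot> s"
      using comp_cong_right[OF pr(1), of m] comp_cong_right[OF pr(2), of m] ps em
      by - (rule binprod_eqI[OF bp], simp_all)
    then obtain h where "h \<in> Arr C" "Dom C h = Dom C m" "Cod C h = Dom C \<phi>'" "\<phi>' \<cdot> h = m"
      using pullback_lift[OF pb, of m s] by auto
    then have "factors_through C m \<phi>'" by (rule factors_throughI)
    then have "factors_through C \<phi> \<phi>'"
      using factors_through_trans[OF phi(3)] phi' by simp
    then show ?thesis using phi phi' unfolding derivable_def is_formula_def by simp
  qed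
  then show "\<exists>\<epsilon> \<in> hom C G A. \<forall>\<phi> \<phi>'.
      interprets_exists C \<pi> \<psi> \<phi> \<and> interprets_subst C \<pi> q \<psi> \<epsilon> \<phi>' \<longrightarrow> derivable C G \<phi> \<phi>'"
    by (intro bexI[of _ \<epsilon>]) auto
qed

end

theorem proposition3p2:
  fixes C :: "('o, 'm) category_data"
  assumes "elementary_topos C"
  shows "full_epsilon_calculus C \<longleftrightarrow> epsilon_topos C"
proof -
  obtain one \<Omega> tr where "category C" "finitely_complete C" "cartesian_closed C"
    "is_subobject_classifier C one \<Omega> tr"
    using assms unfolding elementary_topos_def by blast
  then interpret topos C one \<Omega> tr by (simp add: topos_def topos_axioms_def)
  show ?thesis
  proof
    assume "full_epsilon_calculus C"
    then show "epsilon_topos C"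
      using assms full_epsilon_calculus_choice full_epsilon_calculus_epic_terminal
      unfolding epsilon_topos_def by simp
  qed (rule epsilon_topos_full_epsilon_calculus)
qed

end
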